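(* Let $n\geq 1$ and let $f\in L^2(\mathbb{R}^n)$ be an eigenfunction of the Fourier transform. Then there exists a positive constant $C$, independent of $a$, such that for every $0<a<1$ for which $$K_a(f) = \int_{\mathbb{R}^n}\int_{\mathbb{R}^n} |f(x)|\,|\hat f(y)|\, e^{a|x\cdot y|}\,dx\,dy < \infty,$$ and for all $\alpha\in\mathbb{N}^n$, $$|(f,\Phi_\alpha)| \leq C e^{t/2} (K_a(f))^{1/2} \left(\prod_{j=1}^n (2\alpha_j+1)^{1/4n}\right) e^{-(2|\alpha|+n)t/2n},$$ where $t>0$ is determined by the condition $a=\tanh(2t)$.
   Context: The Fourier transform is $\hat f(y) = (2\pi)^{-n/2}\int_{\mathbb{R}^n} f(x) e^{-i x\cdot y}\,dx$, extended to $L^2(\mathbb{R}^n)$ as usual. $\mathbb{N}=\{0,1,2,\ldots\}$ and $|\alpha|=\alpha_1+\cdots+\alpha_n$ for $\alpha\in\mathbb{N}^n$. $\Phi_\alpha$ are the normalised Hermite functions on $\mathbb{R}^n$: $\Phi_\alpha(x)=\prod_{j=1}^n h_{\alpha_j}(x_j)$, where $h_k(s) = (2^k k!\sqrt{\pi})^{-1/2} H_k(s) e^{-s^2/2}$ and $H_k(s) = (-1)^k e^{s^2}\frac{d^k}{ds^k}e^{-s^2}$. $(f,\Phi_\alpha)=\int_{\mathbb{R}^n} f(x)\Phi_\alpha(x)\,dx$. The exponents $1/4n$ and $(2|\alpha|+n)t/2n$ mean $1/(4n)$ and $(2|\alpha|+n)t/(2n)$. *)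

theory Defs
  imports "HOL-Analysis.Analysis"
begin

text \<open>
  Elements of \<open>L\<^sup>2(\<real>\<^sup>n)\<close> are represented by Borel measurable complex-valued functions on
  \<open>real ^ 'n\<close>, with \<open>n = CARD('n)\<close>; every class contains such a representative.
\<close>

definition square_integrable :: "(real ^ 'n \<Rightarrow> complex) \<Rightarrow> bool" where
  "square_integrable f \<longleftrightarrow>
     f \<in> borel_measurable lborel \<and> integrable lborel (\<lambda>x. (norm (f x))\<^sup>2)"

text \<open>
  Convergence in \<open>L\<^sup>2\<close>, with the extended nonnegative integral so that a non-integrable
  difference does not count as having norm zero.
\<close>

definition L2_converges :: "(nat \<Rightarrow> real ^ 'n \<Rightarrow> complex) \<Rightarrow> (real ^ 'n \<Rightarrow> complex) \<Rightarrow> bool" where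
  "L2_converges u f \<longleftrightarrow>
     (\<lambda>k. \<integral>\<^sup>+ x. ennreal ((norm (u k x - f x))\<^sup>2) \<partial>lborel) \<longlonglongrightarrow> 0"

definition fourier_L1 :: "(real ^ 'n \<Rightarrow> complex) \<Rightarrow> real ^ 'n \<Rightarrow> complex" where
  "fourier_L1 f y =
     of_real ((2 * pi) powr (- real CARD('n) / 2)) *
     (LINT x|lborel. f x * exp (- \<i> * of_real (x \<bullet> y)))"

text \<open>
  The extension of the Fourier transform to \<open>L\<^sup>2\<close> by density of \<open>L\<^sup>1 \<inter> L\<^sup>2\<close>. It is a relation
  rather than a function because the transform is only determined up to null sets:
  \<open>is_fourier_L2 f g\<close> says that \<open>g\<close> is a representative of the transform of \<open>f\<close>.
\<close>

definition is_fourier_L2 :: "(real ^ 'n \<Rightarrow> complex) \<Rightarrow> (real ^ 'n \<Rightarrow> complex) \<Rightarrow> bool" where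
  "is_fourier_L2 f g \<longleftrightarrow>
     square_integrable f \<and> square_integrable g \<and>
     (\<exists>u. (\<forall>k. integrable lborel (u k) \<and> square_integrable (u k)) \<and>
          L2_converges u f \<and> L2_converges (\<lambda>k. fourier_L1 (u k)) g)"

definition fourier_eigenfunction :: "(real ^ 'n \<Rightarrow> complex) \<Rightarrow> bool" where
  "fourier_eigenfunction f \<longleftrightarrow>
     square_integrable f \<and> \<not> (AE x in lborel. f x = 0) \<and>
     (\<exists>c::complex. is_fourier_L2 f (\<lambda>x. c * f x))"

definition hermite_poly :: "nat \<Rightarrow> real \<Rightarrow> real" where
  "hermite_poly k s = (- 1) ^ k * exp (s\<^sup>2) * (deriv ^^ k) (\<lambda>r. exp (- r\<^sup>2)) s"

definition hermite_fun :: "nat \<Rightarrow> real \<Rightarrow> real" where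
  "hermite_fun k s =
     (2 ^ k * fact k * sqrt pi) powr (- 1 / 2) * hermite_poly k s * exp (- s\<^sup>2 / 2)"

definition hermite_Phi :: "nat ^ 'n \<Rightarrow> real ^ 'n \<Rightarrow> real" where
  "hermite_Phi \<alpha> x = (\<Prod>j\<in>UNIV. hermite_fun (\<alpha> $ j) (x $ j))"

definition hermite_coeff :: "(real ^ 'n \<Rightarrow> complex) \<Rightarrow> nat ^ 'n \<Rightarrow> complex" where
  "hermite_coeff f \<alpha> = (LINT x|lborel. f x * of_real (hermite_Phi \<alpha> x))"

text \<open>
  \<open>K_int a f g\<close> is the integral \<open>K\<^sub>a(f)\<close> when \<open>g\<close> is the Fourier transform of \<open>f\<close>; it does not
  depend on the choice of the representative \<open>g\<close>.
\<close>

definition K_int :: "real \<Rightarrow> (real ^ 'n \<Rightarrow> complex) \<Rightarrow> (real ^ 'n \<Rightarrow> complex) \<Rightarrow> ennreal" where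
  "K_int a f g =
     (\<integral>\<^sup>+ x. \<integral>\<^sup>+ y. ennreal (norm (f x) * norm (g y) * exp (a * \<bar>x \<bullet> y\<bar>)) \<partial>lborel \<partial>lborel)"

end

theory Submission
  imports Defs "HOL-Probability.Probability" "HOL-Complex_Analysis.Complex_Analysis" "HOL-Real_Asymp.Real_Asymp"
begin

text \<open>
  The proof works with the Bargmann transform \<open>F(z) = \<integral> f(x) k(z, x) dx\<close> for \<open>z \<in> \<complex>\<^sup>n\<close>, an entire
  function whose Taylor coefficients are the Hermite coefficients of \<open>f\<close> divided by \<open>\<surd>(\<alpha>!)\<close>, up to a
  constant factor. The Fourier transform of \<open>f\<close> corresponds to the rotation \<open>z \<mapsto> - \<i> z\<close>
  (\<open>bargmann_transform_fourier\<close>), so for an eigenfunction \<open>\<bar>F(- \<i> z)\<bar>\<close> and \<open>\<bar>F(z)\<bar>\<close> are proportional.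

  Write \<open>a = tanh (2 t)\<close> and \<open>q = (1 - a)/(1 + a) = exp (- 4 t)\<close>. Writing \<open>\<bar>F(z)\<bar>\<^sup>2\<close> as a double integral over
  \<open>x\<close> and \<open>y\<close> and maximising the exponent against the weight \<open>exp (a \<bar>x \<bullet> y\<bar>)\<close> gives
  \<open>\<bar>F(z)\<bar>\<^sup>2 \<le> M K exp (q \<bar>Re z\<bar>\<^sup>2 + \<bar>Im z\<bar>\<^sup>2)\<close>, where \<open>K\<close> is the integral in the hypothesis and \<open>M\<close> depends
  on the eigenvalue (\<open>bargmann_transform_product_bound\<close>); the rotation exchanges \<open>Re z\<close> and \<open>Im z\<close>.
  The two bounds together imply, by a Phragmen-Lindelof argument in one variable \<open>z\<^sub>j\<close> with the
  others fixed, growth of \<open>\<bar>F\<bar>\<^sup>2\<close> like \<open>exp (\<surd>q \<bar>z\<^sub>j\<bar>\<^sup>2)\<close> in this variable, with \<open>\<surd>q = exp (- 2 t)\<close>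
  (\<open>gaussian_phragmen_lindelof\<close>, \<open>bargmann_transform_eigen_bound\<close>). Cauchy's estimate on a circle of
  squared radius about \<open>\<alpha>\<^sub>j / \<surd>q\<close> then produces the factor \<open>(2 \<alpha>\<^sub>j + 1) powr (1/4) * exp (- t \<alpha>\<^sub>j)\<close>.

  The other variables must not contribute further powers of \<open>\<alpha>\<^sub>i\<close>. On the circle
  \<open>\<bar>z\<^sub>i\<bar> = r\<close> the bound for \<open>\<bar>F\<bar>\<close> reaches its maximum \<open>exp (r\<^sup>2/2)\<close> only at the four points on the axes and
  decays like a Gaussian of width of order \<open>1/r\<close> away from them. The mean over the circle is
  therefore smaller than the maximum by a factor of order \<open>1/r\<close>, which outweighs the Stirling loss
  \<open>(\<alpha>\<^sub>i + 1) powr (1/4)\<close> (\<open>circle_mean_gaussian_sin\<close>, \<open>hermite_coeff_coordinate_bound\<close>).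

  The resulting constant is uniform only for \<open>t \<ge> t0 > 0\<close>. Here \<open>t0\<close> may be any value for which the
  integral is finite, and for smaller \<open>t\<close> the bound at \<open>t0\<close> is used, together with the positive lower
  bound for \<open>K\<close> given by the product of the \<open>L\<^sup>1\<close> norms. Finally the bounds for the single
  coordinates \<open>j\<close> are combined by taking their geometric mean, which is where the exponents
  \<open>1/(4 n)\<close> and \<open>t/(2 n)\<close> come from.
\<close>

section \<open>A Phragmen-Lindelof principle for Gaussian bounds\<close>

text \<open>
  The sector \<open>\<bar>arg z\<bar> \<le> \<beta>\<close> has opening less than \<open>\<pi>/2\<close>, so a power \<open>z\<^sup>p\<close> with \<open>p > 2\<close> still has
  positive real part on it; the factor \<open>exp (- \<epsilon> z\<^sup>p)\<close> beats growth of order 2 and disappears as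
  \<open>\<epsilon>\<close> tends to 0. The coordinate \<open>w = Log z\<close> replaces \<open>z\<^sup>p\<close> by the entire function \<open>exp (p w)\<close> and
  the sector by a strip, in which the maximum principle is applied to a rectangle.
\<close>

lemma phragmen_lindelof_sector:
  fixes H :: "complex \<Rightarrow> complex"
  assumes holo: "H holomorphic_on UNIV"
    and beta: "0 < \<beta>" "\<beta> < pi / 4"
    and growth: "\<And>z. norm (H z) \<le> D * exp (E * (norm z)\<^sup>2)"
    and rays: "\<And>r. r \<ge> 0 \<Longrightarrow> norm (H (of_real r * cis \<beta>)) \<le> L"
      "\<And>r. r \<ge> 0 \<Longrightarrow> norm (H (of_real r * cis (- \<beta>))) \<le> L"
    and z: "r > 0" "\<bar>\<phi>\<bar> \<le> \<beta>"
  shows "norm (H (of_real r * cis \<phi>)) \<le> L"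
proof -
  obtain s where s: "s > 0" "(2 + s) * \<beta> < pi / 2"
  proof
    show "(pi / (2 * \<beta>) - 2) / 2 > 0" using beta by (simp add: field_simps)
    show "(2 + (pi / (2 * \<beta>) - 2) / 2) * \<beta> < pi / 2" using beta by (simp add: field_simps)
  qed
  define p where "p = 2 + s"
  have p: "p > 0" "p * \<beta> < pi / 2" using s by (auto simp: p_def)
  define \<delta> where "\<delta> = cos (p * \<beta>)"
  have \<delta>: "\<delta> > 0" unfolding \<delta>_def using p beta by (intro cos_gt_zero_pi) (auto intro: less_trans[OF _ mult_pos_pos])
  \<comment> \<open>The Cartesian coordinates of the point in the strip are its logarithmic polar coordinates.\<close>
  define w0 where "w0 = Complex (ln r) \<phi>"
  have expw0: "exp w0 = of_real r * cis \<phi>"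
    using z by (simp add: w0_def exp_eq_polar)
  have L0: "norm (H 0) \<le> L" using rays(1)[of 0] by simp
  hence L_nn: "L \<ge> 0" using norm_ge_zero order_trans by blast
  have key: "norm (H (exp w0)) * exp (- (\<epsilon> * Re (exp (of_real p * w0)))) \<le> L + \<epsilon>" if e: "\<epsilon> > 0" for \<epsilon>
  proof -
    define U where "U = (\<lambda>w. H (exp w) * exp (- (of_real \<epsilon> * exp (of_real p * w))))"
    have normU: "norm (U w) = norm (H (exp w)) * exp (- (\<epsilon> * Re (exp (of_real p * w))))" for w
      by (simp add: U_def norm_mult)
    have Re_exp: "Re (exp (of_real p * w)) \<ge> \<delta> * exp (p * Re w)" if "\<bar>Im w\<bar> \<le> \<beta>" for w
    proof -
      have "\<bar>p * Im w\<bar> \<le> p * \<beta>" using that p by (simp add: abs_mult)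
      hence "cos \<bar>p * Im w\<bar> \<ge> cos (p * \<beta>)"
        using p by (intro cos_monotone_0_pi_le) auto
      thus ?thesis by (simp add: Re_exp \<delta>_def)
    qed
    have "isCont H 0" using holo holomorphic_on_imp_continuous_on continuous_on_eq_continuous_at[OF open_UNIV] by blast
    then obtain d where d: "d > 0" "\<And>u. norm u < d \<Longrightarrow> norm (H u - H 0) < \<epsilon>"
      using e unfolding continuous_at_eps_delta by (auto simp: dist_norm)
    \<comment> \<open>The vertex of the sector lies at the left end of the strip, where \<open>H\<close> is within \<open>\<epsilon>\<close> of \<open>H 0\<close>.\<close>
    define a where "a = min (Re w0) (ln (d / 2))"
    have left: "norm (U w) \<le> L + \<epsilon>" if "Re w = a" "\<bar>Im w\<bar> \<le> \<beta>" for w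
    proof -
      have "norm (exp w) \<le> exp (ln (d / 2))" using that by (simp add: a_def)
      hence "norm (exp w) < d" using d(1) by simp
      hence "norm (H (exp w)) \<le> L + \<epsilon>"
        using d(2)[of "exp w"] L0 norm_triangle_ineq2[of "H (exp w)" "H 0"] by linarith
      moreover have "exp (- (\<epsilon> * Re (exp (of_real p * w)))) \<le> 1"
        using Re_exp[OF that(2)] \<delta> e by (simp add: order_trans[OF _ Re_exp[OF that(2)]])
      ultimately have "norm (H (exp w)) * exp (- (\<epsilon> * Re (exp (of_real p * w)))) \<le> (L + \<epsilon>) * 1"
        by (intro mult_mono) (use L_nn e in auto)
      thus ?thesis by (simp add: normU)
    qed
    have "((\<lambda>R. D * exp (E * exp (2 * R) - \<epsilon> * \<delta> * exp ((2 + s) * R))) \<longlongrightarrow> 0) at_top"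
      using s(1) e \<delta> by real_asymp
    hence "eventually (\<lambda>R. D * exp (E * exp (2 * R) - \<epsilon> * \<delta> * exp ((2 + s) * R)) < L + \<epsilon>) at_top"
      by (rule order_tendstoD) (use L_nn e in auto)
    then obtain b where b: "b \<ge> Re w0" "D * exp (E * exp (2 * b) - \<epsilon> * \<delta> * exp (p * b)) < L + \<epsilon>"
      unfolding eventually_at_top_linorder p_def by (meson max.cobounded1 max.cobounded2)
    have D_nn: "D \<ge> 0" using growth[of 0] norm_ge_zero[of "H 0"] by (simp del: norm_ge_zero)
    have right: "norm (U w) \<le> L + \<epsilon>" if "Re w = b" "\<bar>Im w\<bar> \<le> \<beta>" for w
    proof -
      have "norm (H (exp w)) \<le> D * exp (E * exp (2 * b))"
        using growth[of "exp w"] that by (simp add: power2_eq_square flip: exp_add)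
      moreover have "exp (- (\<epsilon> * Re (exp (of_real p * w)))) \<le> exp (- (\<epsilon> * \<delta> * exp (p * b)))"
        using Re_exp[OF that(2)] e that by (simp add: mult.assoc)
      ultimately have "norm (U w) \<le> (D * exp (E * exp (2 * b))) * exp (- (\<epsilon> * \<delta> * exp (p * b)))"
        unfolding normU by (intro mult_mono) (use D_nn in auto)
      also have "\<dots> = D * exp (E * exp (2 * b) - \<epsilon> * \<delta> * exp (p * b))"
        by (simp add: exp_diff exp_minus field_simps)
      finally show ?thesis using b by simp
    qed
    have side: "norm (U w) \<le> L + \<epsilon>" if "\<bar>Im w\<bar> = \<beta>" for w
    proof -
      have "exp w = of_real (exp (Re w)) * cis (Im w)" by (simp add: exp_eq_polar)
      moreover have "Im w = \<beta> \<or> Im w = - \<beta>" using that by auto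
      ultimately have "norm (H (exp w)) \<le> L" using rays by auto
      moreover have "exp (- (\<epsilon> * Re (exp (of_real p * w)))) \<le> 1"
        using Re_exp[of w] that \<delta> e by (simp add: order_trans[OF _ Re_exp])
      ultimately have "norm (H (exp w)) * exp (- (\<epsilon> * Re (exp (of_real p * w)))) \<le> L * 1"
        by (intro mult_mono) (use L_nn e in auto)
      thus ?thesis using e by (simp add: normU)
    qed
    let ?S = "cbox (Complex a (- \<beta>)) (Complex b \<beta>)"
    have "(H \<circ> exp) holomorphic_on UNIV"
      by (intro holomorphic_on_compose_gen[OF _ holo] holomorphic_intros) auto
    hence holoU: "U holomorphic_on UNIV"
      unfolding U_def by (intro holomorphic_intros) (simp add: o_def)
    have "norm (U w0) \<le> L + \<epsilon>"
    proof (rule maximum_modulus_frontier[of U ?S])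
      show "U holomorphic_on interior ?S" using holoU holomorphic_on_subset by blast
      show "continuous_on (closure ?S) U"
        using holoU holomorphic_on_imp_continuous_on continuous_on_subset by blast
      show "bounded ?S" by simp
      show "w0 \<in> ?S" using z b by (auto simp: w0_def a_def in_cbox_complex_iff)
      show "norm (U w) \<le> L + \<epsilon>" if "w \<in> frontier ?S" for w
      proof -
        have "w \<in> ?S" "w \<notin> box (Complex a (- \<beta>)) (Complex b \<beta>)"
          using that by (auto simp: frontier_def)
        hence "Re w \<in> {a..b}" "Im w \<in> {-\<beta>..\<beta>}" "Re w = a \<or> Re w = b \<or> \<bar>Im w\<bar> = \<beta>"
          by (auto simp: in_cbox_complex_iff in_box_complex_iff)
        thus ?thesis using left right side by fastforce
      qed
    qed
    thus ?thesis by (simp add: normU)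
  qed
  have lim1: "((\<lambda>\<epsilon>. norm (H (exp w0)) * exp (- (\<epsilon> * Re (exp (of_real p * w0))))) \<longlongrightarrow>
      norm (H (exp w0)) * exp (- (0 * Re (exp (of_real p * w0))))) (at_right 0)"
    by (intro tendsto_intros)
  have lim2: "((\<lambda>\<epsilon>. L + \<epsilon>) \<longlongrightarrow> L + 0) (at_right 0)" by (intro tendsto_intros)
  have "norm (H (exp w0)) * exp (- (0 * Re (exp (of_real p * w0)))) \<le> L + 0"
    by (rule tendsto_le[OF trivial_limit_at_right_real lim2 lim1])
       (auto simp: eventually_at_filter key)
  thus ?thesis by (simp add: expw0)
qed

text \<open>
  On a ray of slope \<open>v/u\<close> the exponent \<open>q u\<^sup>2 + v\<^sup>2\<close> exceeds \<open>2 \<surd>q u v\<close> by \<open>(\<surd>q u - v)\<^sup>2\<close>, so the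
  two are equal exactly on the ray of slope \<open>\<surd>q\<close>, and by symmetry the second bound meets the
  same quantity on the ray of slope \<open>1/\<surd>q\<close>. Between these rays \<open>2 \<surd>q u v\<close> is the real part of
  \<open>- \<i> \<surd>q z\<^sup>2\<close>, hence \<open>G\<^sup>2 exp (\<i> \<surd>q z\<^sup>2)\<close> is bounded on the two rays and the sector principle applies.
  Outside of them one of the two hypotheses already gives the claim.
\<close>

lemma gaussian_phragmen_lindelof_quadrant:
  fixes G :: "complex \<Rightarrow> complex"
  assumes holo: "G holomorphic_on UNIV" and q: "0 < q" "q < 1"
    and b1: "\<And>z. (norm (G z))\<^sup>2 \<le> L * exp (q * (Re z)\<^sup>2 + (Im z)\<^sup>2)"
    and b2: "\<And>z. (norm (G z))\<^sup>2 \<le> L * exp ((Re z)\<^sup>2 + q * (Im z)\<^sup>2)"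
    and z: "Re z \<ge> 0" "Im z \<ge> 0"
  shows "(norm (G z))\<^sup>2 \<le> L * exp (sqrt q * (norm z)\<^sup>2)"
proof -
  define s where "s = sqrt q"
  have s: "0 < s" "s < 1" "s\<^sup>2 = q" using q by (auto simp: s_def)
  have L: "L \<ge> 0" using b1[of 0] by (simp add: order_trans[OF zero_le_power2])
  define x y where "x = Re z" and "y = Im z"
  have nz: "(norm z)\<^sup>2 = x\<^sup>2 + y\<^sup>2" by (simp add: cmod_power2 x_def y_def)
  have aux: "q * u\<^sup>2 + v\<^sup>2 \<le> s * (u\<^sup>2 + v\<^sup>2)" if "0 \<le> v" "v \<le> s * u" for u v :: real
  proof -
    have "v\<^sup>2 \<le> (s * u)\<^sup>2" using that by (intro power_mono) auto
    also have "\<dots> = s * (s * u\<^sup>2)" by (simp add: power2_eq_square)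
    also have "\<dots> \<le> 1 * (s * u\<^sup>2)" using s by (intro mult_right_mono) auto
    finally have "(1 - s) * v\<^sup>2 \<le> (1 - s) * (s * u\<^sup>2)" using s by (intro mult_left_mono) auto
    thus ?thesis unfolding s(3)[symmetric] by (simp add: algebra_simps power2_eq_square)
  qed
  consider "y \<le> s * x" | "x \<le> s * y" | "s * x < y" "s * y < x" by linarith
  thus ?thesis
  proof cases
    case 1
    have "(norm (G z))\<^sup>2 \<le> L * exp (q * x\<^sup>2 + y\<^sup>2)" using b1 by (simp add: x_def y_def)
    also have "\<dots> \<le> L * exp (s * (x\<^sup>2 + y\<^sup>2))"
      using aux[of y x] 1 z L by (intro mult_left_mono) (auto simp: x_def y_def)
    finally show ?thesis by (simp add: nz s_def)
  next
    case 2
    have "(norm (G z))\<^sup>2 \<le> L * exp (x\<^sup>2 + q * y\<^sup>2)" using b2 by (simp add: x_def y_def)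
    also have "\<dots> \<le> L * exp (s * (x\<^sup>2 + y\<^sup>2))"
      using aux[of x y] 2 z L by (intro mult_left_mono) (auto simp: x_def y_def algebra_simps)
    finally show ?thesis by (simp add: nz s_def)
  next
    case 3
    have xy: "x > 0" "y > 0" using 3 z s by (auto simp: x_def y_def) (smt (verit) mult_nonneg_nonneg)+
    \<comment> \<open>The rotation by \<open>\<pi>/4\<close> makes the sector symmetric about the positive real axis and turns
        \<open>exp (\<i> \<surd>q z\<^sup>2)\<close> into \<open>exp (- \<surd>q w\<^sup>2)\<close>.\<close>
    define H where "H = (\<lambda>w. (G (cis (pi/4) * w))\<^sup>2 * exp (- (of_real s * w\<^sup>2)))"
    have norm_gauss: "norm (exp (- (of_real s * w\<^sup>2))) = exp (- (2 * s * Re (cis (pi/4) * w) * Im (cis (pi/4) * w)))" for w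
      by (simp add: cos_45 sin_45 algebra_simps power2_eq_square)
    have normH: "norm (H w) = (norm (G (cis (pi/4) * w)))\<^sup>2 * exp (- (2 * s * Re (cis (pi/4) * w) * Im (cis (pi/4) * w)))" for w
      unfolding H_def norm_mult norm_gauss by (simp add: norm_power)
    have "(G \<circ> (\<lambda>w. cis (pi/4) * w)) holomorphic_on UNIV"
      by (intro holomorphic_on_compose_gen[OF _ holo] holomorphic_intros) auto
    hence holoH: "H holomorphic_on UNIV"
      unfolding H_def by (intro holomorphic_intros) (simp add: o_def)
    define \<theta>0 where "\<theta>0 = arctan s"
    define \<beta> where "\<beta> = pi / 4 - \<theta>0"
    have t0: "0 < \<theta>0" "\<theta>0 < pi / 4" using s arctan_less_iff[of s 1] by (auto simp: \<theta>0_def arctan_one)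
    have ct0: "cos \<theta>0 > 0" using t0 by (intro cos_gt_zero) auto
    have st0: "sin \<theta>0 = s * cos \<theta>0" using ct0 tan_arctan[of s] by (simp add: tan_def \<theta>0_def field_simps)
    have growth: "norm (H w) \<le> L * exp (2 * (norm w)\<^sup>2)" for w
    proof -
      let ?u = "cis (pi/4) * w"
      have "(norm (G ?u))\<^sup>2 \<le> L * exp ((norm w)\<^sup>2)"
      proof -
        have "q * (Re ?u)\<^sup>2 + (Im ?u)\<^sup>2 \<le> (norm w)\<^sup>2"
        proof -
          have "(norm w)\<^sup>2 = (norm ?u)\<^sup>2" by (simp add: norm_mult)
          also have "\<dots> = (Re ?u)\<^sup>2 + (Im ?u)\<^sup>2" by (simp only: cmod_power2)
          finally have "(norm w)\<^sup>2 = (Re ?u)\<^sup>2 + (Im ?u)\<^sup>2" .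
          moreover have "q * (Re ?u)\<^sup>2 \<le> 1 * (Re ?u)\<^sup>2" using q by (intro mult_right_mono) auto
          ultimately show ?thesis by linarith
        qed
        thus ?thesis using b1[of ?u] L by (smt (verit) mult_left_mono exp_le_cancel_iff)
      qed
      moreover have "norm (exp (- (of_real s * w\<^sup>2))) \<le> exp ((norm w)\<^sup>2)"
      proof -
        have "norm (exp (- (of_real s * w\<^sup>2))) \<le> exp (norm (- (of_real s * w\<^sup>2)))" by (rule norm_exp)
        also have "norm (- (of_real s * w\<^sup>2)) \<le> 1 * (norm w)\<^sup>2"
          unfolding norm_minus_cancel norm_mult norm_power using s by (intro mult_right_mono) auto
        finally show ?thesis by simp
      qed
      ultimately have "norm (H w) \<le> (L * exp ((norm w)\<^sup>2)) * exp ((norm w)\<^sup>2)"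
        unfolding H_def norm_mult norm_power by (intro mult_mono) (use L in auto)
      thus ?thesis by (simp add: mult.assoc flip: exp_add)
    qed
    have ray1: "norm (H (of_real r * cis (- \<beta>))) \<le> L" if "r \<ge> 0" for r
    proof -
      let ?u = "cis (pi/4) * (of_real r * cis (- \<beta>))"
      have u: "?u = of_real r * cis \<theta>0" by (simp add: \<beta>_def cis_mult mult.left_commute)
      have R: "Im ?u = s * Re ?u" unfolding u using st0 by simp
      have "norm (H (of_real r * cis (- \<beta>))) \<le> L * exp (q * (Re ?u)\<^sup>2 + (Im ?u)\<^sup>2) * exp (- (2 * s * Re ?u * Im ?u))"
        unfolding normH by (intro mult_right_mono b1) auto
      also have "\<dots> = L" unfolding R mult.assoc exp_add[symmetric] s(3)[symmetric] by (simp add: power2_eq_square)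
      finally show ?thesis .
    qed
    have ray2: "norm (H (of_real r * cis \<beta>)) \<le> L" if "r \<ge> 0" for r
    proof -
      let ?u = "cis (pi/4) * (of_real r * cis \<beta>)"
      have u: "?u = of_real r * cis (pi / 2 - \<theta>0)" by (simp add: \<beta>_def cis_mult mult.left_commute)
      have R: "Re ?u = s * Im ?u" unfolding u using st0 by (simp add: cos_diff sin_diff)
      have "norm (H (of_real r * cis \<beta>)) \<le> L * exp ((Re ?u)\<^sup>2 + q * (Im ?u)\<^sup>2) * exp (- (2 * s * Re ?u * Im ?u))"
        unfolding normH by (intro mult_right_mono b2) auto
      also have "\<dots> = L" unfolding R mult.assoc exp_add[symmetric] s(3)[symmetric] by (simp add: power2_eq_square)
      finally show ?thesis .
    qed
    define \<theta> where "\<theta> = arctan (y / x)"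
    have th: "\<bar>\<theta> - pi / 4\<bar> \<le> \<beta>"
    proof -
      have "\<theta> \<ge> \<theta>0" using 3 xy by (simp add: \<theta>_def \<theta>0_def arctan_le_iff field_simps)
      moreover have "\<theta> \<le> pi / 2 - \<theta>0"
      proof -
        have "pi / 2 - \<theta>0 = arctan (1 / s)"
          using arctan_inverse[of s] s by (simp add: \<theta>0_def inverse_eq_divide)
        moreover have "y / x \<le> 1 / s" using 3 xy s by (simp add: field_simps)
        ultimately show ?thesis by (simp add: \<theta>_def arctan_le_iff)
      qed
      ultimately show ?thesis by (simp add: \<beta>_def abs_le_iff)
    qed
    have zpol: "z = of_real (norm z) * cis \<theta>"
    proof -
      have "norm z = x * sqrt (1 + (y / x)\<^sup>2)"
      proof -
        have "x * sqrt (1 + (y / x)\<^sup>2) = sqrt (x\<^sup>2 * (1 + (y / x)\<^sup>2))"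
          using xy by (simp add: real_sqrt_mult)
        also have "x\<^sup>2 * (1 + (y / x)\<^sup>2) = x\<^sup>2 + y\<^sup>2"
          using xy by (simp add: field_simps)
        finally show ?thesis by (simp add: cmod_def x_def y_def)
      qed
      moreover have "sqrt (1 + (y / x)\<^sup>2) \<noteq> 0" by (simp add: add_nonneg_eq_0_iff)
      ultimately show ?thesis using xy
        by (intro complex_eqI) (simp_all add: \<theta>_def cos_arctan sin_arctan x_def y_def)
    qed
    have "norm (H (of_real (norm z) * cis (\<theta> - pi / 4))) \<le> L"
      by (rule phragmen_lindelof_sector[OF holoH, of \<beta> L 2])
         (use growth ray1 ray2 th t0 xy in \<open>auto simp: \<beta>_def x_def\<close>)
    moreover have "cis (pi/4) * (of_real (norm z) * cis (\<theta> - pi / 4)) = z"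
      by (subst (2) zpol) (simp add: cis_mult mult.left_commute)
    ultimately have "(norm (G z))\<^sup>2 * exp (- (2 * s * x * y)) \<le> L" by (simp only: normH x_def y_def)
    hence "(norm (G z))\<^sup>2 \<le> L * exp (2 * s * x * y)" by (simp add: exp_minus field_simps)
    also have "\<dots> \<le> L * exp (s * (x\<^sup>2 + y\<^sup>2))"
    proof -
      have "2 * x * y \<le> x\<^sup>2 + y\<^sup>2" using sum_squares_bound[of x y] .
      hence "s * (2 * x * y) \<le> s * (x\<^sup>2 + y\<^sup>2)" using s by (intro mult_left_mono) auto
      thus ?thesis using L by (intro mult_left_mono) (auto simp: mult_ac)
    qed
    finally show ?thesis by (simp add: nz s_def)
  qed
qed

text \<open>
  The two hypotheses are exchanged by \<open>z \<mapsto> \<i> z\<close>, so every quadrant can be rotated to the first.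
\<close>

lemma gaussian_phragmen_lindelof:
  fixes G :: "complex \<Rightarrow> complex"
  assumes holo: "G holomorphic_on UNIV" and q: "0 < q" "q < 1"
    and b1: "\<And>z. (norm (G z))\<^sup>2 \<le> L * exp (q * (Re z)\<^sup>2 + (Im z)\<^sup>2)"
    and b2: "\<And>z. (norm (G z))\<^sup>2 \<le> L * exp ((Re z)\<^sup>2 + q * (Im z)\<^sup>2)"
  shows "(norm (G z))\<^sup>2 \<le> L * exp (sqrt q * (norm z)\<^sup>2)"
proof -
  have step: "(norm (G z))\<^sup>2 \<le> L * exp (sqrt q * (norm z)\<^sup>2)"
    if w: "Re (\<omega> * z) \<ge> 0" "Im (\<omega> * z) \<ge> 0" "\<omega> \<in> {1, -1, \<i>, -\<i>}" for \<omega>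
  proof -
    have "(G \<circ> (\<lambda>w. cnj \<omega> * w)) holomorphic_on UNIV"
      by (intro holomorphic_on_compose_gen[OF _ holo] holomorphic_intros) auto
    hence "(\<lambda>w. G (cnj \<omega> * w)) holomorphic_on UNIV" by (simp add: o_def)
    hence "(norm (G (cnj \<omega> * (\<omega> * z))))\<^sup>2 \<le> L * exp (sqrt q * (norm (\<omega> * z))\<^sup>2)"
    proof (rule gaussian_phragmen_lindelof_quadrant[OF _ q])
      show "(norm (G (cnj \<omega> * w)))\<^sup>2 \<le> L * exp (q * (Re w)\<^sup>2 + (Im w)\<^sup>2)" for w
        using b1[of "cnj \<omega> * w"] b2[of "cnj \<omega> * w"] w(3) by (auto simp: add_ac)
      show "(norm (G (cnj \<omega> * w)))\<^sup>2 \<le> L * exp ((Re w)\<^sup>2 + q * (Im w)\<^sup>2)" for w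
        using b1[of "cnj \<omega> * w"] b2[of "cnj \<omega> * w"] w(3) by (auto simp: add_ac)
    qed (use w in auto)
    moreover have "cnj \<omega> * (\<omega> * z) = z" "norm (\<omega> * z) = norm z" using w(3) by (auto simp: norm_mult)
    ultimately show ?thesis by simp
  qed
  consider "Re z \<ge> 0" "Im z \<ge> 0" | "Re z \<le> 0" "Im z \<ge> 0" | "Re z \<ge> 0" "Im z \<le> 0" | "Re z \<le> 0" "Im z \<le> 0"
    by linarith
  thus ?thesis
  proof cases
    case 1 thus ?thesis by (intro step[of 1]) auto
  next
    case 2 thus ?thesis by (intro step[of "-\<i>"]) auto
  next
    case 3 thus ?thesis by (intro step[of \<i>]) auto
  next
    case 4 thus ?thesis by (intro step[of "-1"]) auto
  qed
qed

section \<open>Stirling's bound and Gaussian means over the circle\<close>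

text \<open>
  This is \<open>e \<le> (1 + 1/n) ^ (n + 1/2)\<close>, the induction step of Stirling's upper bound. With
  \<open>x = 1/(2n+1)\<close> it reads \<open>2 x \<le> ln ((1 + x)/(1 - x))\<close>, which follows by differentiating.
\<close>

lemma stirling_ratio_bound:
  assumes "n \<ge> (1::nat)"
  shows "exp 1 * sqrt (real n) * real n ^ n \<le> sqrt (real (Suc n)) * real (Suc n) ^ n"
proof -
  define x where "x = 1 / (2 * real n + 1)"
  have x: "0 \<le> x" "x < 1" using assms by (auto simp: x_def)
  have "ln (1 + 0) - ln (1 - 0) - 2 * 0 \<le> ln (1 + x) - ln (1 - x) - 2 * x"
  proof (rule DERIV_nonneg_imp_nondecreasing[OF x(1)])
    fix y assume y: "0 \<le> y" "y \<le> x"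
    have "((\<lambda>y. ln (1 + y) - ln (1 - y) - 2 * y) has_real_derivative (1 / (1 + y) + 1 / (1 - y) - 2)) (at y)"
      using y x by (auto intro!: derivative_eq_intros)
    moreover have "1 / (1 + y) + 1 / (1 - y) - 2 = 2 * y\<^sup>2 / ((1 + y) * (1 - y))"
    proof -
      have "1 + y \<noteq> 0" "1 - y \<noteq> 0" using y x by auto
      thus ?thesis by (simp add: divide_simps) (simp add: algebra_simps power2_eq_square)
    qed
    moreover have "\<dots> \<ge> 0" using y x by simp
    ultimately show "\<exists>D. ((\<lambda>y. ln (1 + y) - ln (1 - y) - 2 * y) has_real_derivative D) (at y) \<and> 0 \<le> D"
      by metis
  qed
  hence "2 * x \<le> ln ((1 + x) / (1 - x))" using x by (simp add: ln_div)
  also have "(1 + x) / (1 - x) = real (Suc n) / real n"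
  proof -
    have "1 + x = 2 * real (Suc n) / (2 * real n + 1)" "1 - x = 2 * real n / (2 * real n + 1)"
      by (simp_all add: x_def field_simps)
    hence "(1 + x) / (1 - x) = (2 * real (Suc n) / (2 * real n + 1)) / (2 * real n / (2 * real n + 1))" by (simp only:)
    moreover have "2 * real n + 1 \<noteq> 0" by linarith
    ultimately show ?thesis using assms by (simp add: divide_simps del: of_nat_Suc)
  qed
  finally have "1 \<le> (real n + 1 / 2) * ln (real (Suc n) / real n)"
    using assms by (simp add: x_def field_simps)
  hence "exp 1 \<le> exp ((real n + 1 / 2) * ln (real (Suc n) / real n))" by simp
  also have "\<dots> = (real (Suc n) / real n) powr (real n + 1 / 2)" using assms by (simp add: powr_def)
  also have "\<dots> = (real (Suc n) / real n) ^ n * sqrt (real (Suc n) / real n)"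
    using assms by (simp add: powr_add powr_half_sqrt powr_realpow)
  also have "\<dots> = (real (Suc n) ^ n * sqrt (real (Suc n))) / (real n ^ n * sqrt (real n))"
    by (simp add: power_divide real_sqrt_divide)
  finally have "exp 1 * (real n ^ n * sqrt (real n)) \<le> real (Suc n) ^ n * sqrt (real (Suc n))"
    using assms by (simp only: pos_le_divide_eq mult_pos_pos zero_less_power real_sqrt_gt_zero of_nat_0_less_iff)
  thus ?thesis by (simp only: mult_ac)
qed

lemma fact_le_stirling:
  assumes "n \<ge> 1"
  shows "fact n * exp (real n) \<le> exp 1 * sqrt (real n) * real n ^ n"
  using assms
proof (induction n rule: dec_induct)
  case (step n)
  have "fact (Suc n) * exp (real (Suc n)) = real (Suc n) * exp 1 * (fact n * exp (real n))"
    by (simp add: exp_add algebra_simps)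
  also have "\<dots> \<le> real (Suc n) * exp 1 * (exp 1 * sqrt (real n) * real n ^ n)"
    by (intro mult_left_mono step.IH) auto
  also have "\<dots> \<le> real (Suc n) * exp 1 * (sqrt (real (Suc n)) * real (Suc n) ^ n)"
    using step.hyps by (intro mult_left_mono stirling_ratio_bound) auto
  finally show ?case by (simp add: mult_ac)
qed auto

text \<open>
  The left-hand side is the square of the loss in a Cauchy estimate on the circle of squared radius \<open>k + 1\<close>: the weight
  \<open>\<surd>(k!)\<close> comes from the normalisation of the Hermite functions, and the radius is chosen to nearly
  minimise \<open>r ^ (- k) exp (r\<^sup>2/2)\<close> while staying positive for \<open>k = 0\<close>.
\<close>

lemma cauchy_weight_bound:
  "fact k * exp (real k + 1) / (real k + 1) ^ k \<le> exp 1 * sqrt (real k + 1)"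
proof -
  have S: "real (Suc k) = real k + 1" "fact (Suc k) = (real k + 1) * fact k" and nz: "real k + 1 \<noteq> 0"
    by (auto simp: add.commute)
  have "fact k * exp (real k + 1) / (real k + 1) ^ k = fact (Suc k) * exp (real (Suc k)) / real (Suc k) ^ Suc k"
    unfolding S power_Suc using nz by simp
  also have "\<dots> \<le> exp 1 * sqrt (real (Suc k))"
    using fact_le_stirling[of "Suc k"] by (simp add: pos_divide_le_eq)
  finally show ?thesis by (simp add: add.commute)
qed

text \<open>
  The circle is parametrised by \<open>\<theta> \<in> [0, 1]\<close>. The measure lives on the whole real line so that
  its measurable sets are the Borel sets and its powers are plain product measures.
\<close>

definition circle_measure :: "real measure" where
  "circle_measure = uniform_measure lborel {0..1}"

lemma sets_circle_measure [simp, measurable_cong]: "sets circle_measure = sets borel"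
  by (simp add: circle_measure_def)

lemma space_circle_measure [simp]: "space circle_measure = UNIV"
  by (simp add: circle_measure_def)

lemma prob_space_circle_measure: "prob_space circle_measure"
  unfolding circle_measure_def by (intro prob_space_uniform_measure) auto

lemma circle_measure_eq_density: "circle_measure = density lborel (\<lambda>x. ennreal (indicat_real {0..1} x))"
  unfolding circle_measure_def uniform_measure_def by (intro density_cong) (auto simp: indicator_def)

lemma integral_circle_measure:
  fixes f :: "real \<Rightarrow> 'b::{banach, second_countable_topology}"
  assumes [measurable]: "f \<in> borel_measurable borel"
  shows "integral\<^sup>L circle_measure f = (LINT \<theta>:{0..1}|lborel. f \<theta>)"
  unfolding circle_measure_eq_density set_lebesgue_integral_def by (subst integral_density) auto

lemma integrable_circle_measure_continuous:
  fixes f :: "real \<Rightarrow> 'b::euclidean_space"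
  assumes "continuous_on UNIV f"
  shows "integrable circle_measure f"
proof -
  have [measurable]: "f \<in> borel_measurable borel" using assms by (rule borel_measurable_continuous_onI)
  have "set_integrable lborel {0..1} f"
    by (rule borel_integrable_atLeastAtMost') (rule continuous_on_subset[OF assms], simp)
  hence "integrable lborel (\<lambda>x. indicat_real {0..1} x *\<^sub>R f x)" by (simp add: set_integrable_def)
  thus ?thesis unfolding circle_measure_eq_density by (subst integrable_density) auto
qed

lemma gaussian_integral_real:
  assumes "b > 0"
  shows "integrable lborel (\<lambda>x::real. exp (- b * (x - \<mu>)\<^sup>2))" "(LINT x|lborel. exp (- b * (x - \<mu>)\<^sup>2)) = sqrt (pi / b)"
proof -
  define \<sigma> where "\<sigma> = 1 / sqrt (2 * b)"
  have \<sigma>: "\<sigma> > 0" "2 * \<sigma>\<^sup>2 = 1 / b" using assms by (auto simp: \<sigma>_def power_divide)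
  have *: "exp (- b * (x - \<mu>)\<^sup>2) = sqrt (pi / b) * normal_density \<mu> \<sigma> x" for x
  proof -
    have "2 * pi * \<sigma>\<^sup>2 = pi * (2 * \<sigma>\<^sup>2)" by simp
    hence "2 * pi * \<sigma>\<^sup>2 = pi / b" unfolding \<sigma>(2) by simp
    moreover have "- (x - \<mu>)\<^sup>2 / (2 * \<sigma>\<^sup>2) = - b * (x - \<mu>)\<^sup>2" unfolding \<sigma>(2) by simp
    moreover have "sqrt (pi / b) \<noteq> 0" using assms by simp
    ultimately show ?thesis unfolding normal_density_def by simp
  qed
  show "integrable lborel (\<lambda>x::real. exp (- b * (x - \<mu>)\<^sup>2))"
    unfolding * using \<sigma> by (intro integrable_mult_right integrable_normal_density)
  show "(LINT x|lborel. exp (- b * (x - \<mu>)\<^sup>2)) = sqrt (pi / b)"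
    unfolding * using \<sigma> integral_normal_density[of \<sigma> \<mu>] by simp
qed

lemma sin_pi_ge:
  assumes "\<bar>u\<bar> \<le> 1 / 2"
  shows "2 * \<bar>u\<bar> \<le> \<bar>sin (pi * u)\<bar>"
proof -
  have *: "2 * v \<le> sin (pi * v)" if "0 \<le> v" "v \<le> 1 / 2" for v :: real
  proof -
    have "concave_on {0..pi} sin"
      by (rule f''_le0_imp_concave[where f'=cos and f''="\<lambda>x. - sin x"])
         (auto intro!: derivative_eq_intros sin_ge_zero)
    from concave_onD[OF this, of "2 * v" 0 "pi / 2"] that show ?thesis by (simp add: mult.commute)
  qed
  show ?thesis using *[of u] *[of "-u"] assms by (cases "u \<ge> 0") auto
qed

text \<open>
  The integrand is concentrated near the five zeros \<open>m/4\<close> of \<open>sin (4 \<pi> \<theta>)\<close> in the unit interval.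
  This decay in \<open>\<beta>\<close> is what compensates the loss of the Cauchy estimate in all coordinates but one.
\<close>

lemma circle_mean_gaussian_sin:
  assumes "\<beta> > 0"
  shows "(LINT \<theta>|circle_measure. exp (- \<beta> * (sin (4 * pi * \<theta>))\<^sup>2)) \<le> 2 / sqrt \<beta>"
proof -
  let ?g = "\<lambda>m \<theta>. exp (- (64 * \<beta>) * (\<theta> - real m / 4)\<^sup>2)"
  have int: "integrable lborel (?g m)" for m
    using assms by (intro gaussian_integral_real) auto
  have le: "indicat_real {0..1} \<theta> *\<^sub>R exp (- \<beta> * (sin (4 * pi * \<theta>))\<^sup>2) \<le> (\<Sum>m\<le>4. ?g m \<theta>)" for \<theta>
  proof (cases "\<theta> \<in> {0..1}")
    case True
    define m where "m = nat (round (4 * \<theta>))"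
    \<comment> \<open>With \<open>u = 4 \<theta> - m\<close> the nearest zero \<open>m/4\<close> is at distance \<open>\<bar>u\<bar>/4\<close>,
        and \<open>\<bar>sin (\<pi> u)\<bar> \<ge> 2 \<bar>u\<bar> = 8 \<bar>\<theta> - m/4\<bar>\<close>; this gives the factor 64.\<close>
    have r: "\<bar>of_int (round (4 * \<theta>)) - 4 * \<theta>\<bar> \<le> 1 / 2" by (rule of_int_round_abs_le)
    have rm: "round (4 * \<theta>) \<ge> 0" "round (4 * \<theta>) \<le> 4"
      using True r by (auto simp: abs_le_iff; linarith)+
    hence m: "m \<le> 4" "real m = of_int (round (4 * \<theta>))" by (auto simp: m_def)
    define u where "u = 4 * \<theta> - real m"
    have u: "\<bar>u\<bar> \<le> 1 / 2" using r by (simp add: u_def m abs_minus_commute)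
    have "sin (4 * pi * \<theta>) = sin (pi * u + real m * pi)" by (simp add: u_def algebra_simps)
    hence "\<bar>sin (4 * pi * \<theta>)\<bar> = \<bar>sin (pi * u)\<bar>" by (simp add: sin_add abs_mult)
    hence "(2 * \<bar>u\<bar>)\<^sup>2 \<le> \<bar>sin (4 * pi * \<theta>)\<bar>\<^sup>2" using sin_pi_ge[OF u] by (intro power_mono) auto
    hence "64 * (\<theta> - real m / 4)\<^sup>2 \<le> (sin (4 * pi * \<theta>))\<^sup>2"
      by (simp add: u_def power2_eq_square algebra_simps)
    hence "exp (- \<beta> * (sin (4 * pi * \<theta>))\<^sup>2) \<le> ?g m \<theta>" using assms by (simp add: mult.assoc)
    also have "?g m \<theta> \<le> (\<Sum>m\<le>4. ?g m \<theta>)" using m by (intro member_le_sum) auto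
    finally show ?thesis using True by simp
  qed (simp add: sum_nonneg)
  have "(LINT \<theta>|circle_measure. exp (- \<beta> * (sin (4 * pi * \<theta>))\<^sup>2)) =
     (LINT \<theta>|lborel. indicat_real {0..1} \<theta> *\<^sub>R exp (- \<beta> * (sin (4 * pi * \<theta>))\<^sup>2))"
    by (subst integral_circle_measure) (auto simp: set_lebesgue_integral_def)
  also have "\<dots> \<le> (LINT \<theta>|lborel. (\<Sum>m\<le>4. ?g m \<theta>))"
  proof (rule integral_mono)
    show "integrable lborel (\<lambda>\<theta>. indicat_real {0..1} \<theta> *\<^sub>R exp (- \<beta> * (sin (4 * pi * \<theta>))\<^sup>2))"
    proof -
      have "continuous_on {0..1} (\<lambda>\<theta>. exp (- \<beta> * (sin (4 * pi * \<theta>))\<^sup>2))" by (intro continuous_intros)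
      from borel_integrable_atLeastAtMost'[OF this] show ?thesis by (simp add: set_integrable_def)
    qed
  qed (use le int in auto)
  also have "\<dots> = (\<Sum>m\<le>(4::nat). sqrt (pi / (64 * \<beta>)))"
    by (subst Bochner_Integration.integral_sum) (use int assms gaussian_integral_real(2)[of "64 * \<beta>"] in auto)
  also have "\<dots> = 5 / 8 * sqrt pi / sqrt \<beta>" by (simp add: real_sqrt_divide real_sqrt_mult)
  also have "\<dots> \<le> 2 / sqrt \<beta>"
  proof -
    have "sqrt pi \<le> sqrt (2^2)" using pi_less_4 by (intro real_sqrt_le_mono) simp
    thus ?thesis using assms by (intro divide_right_mono) auto
  qed
  finally show ?thesis .
qed

section \<open>Hermite functions as circle means of the Bargmann kernel\<close>

text \<open>
  The kernel of the Bargmann transform, without its factor \<open>\<pi> powr (- 1/4)\<close>. It is the generating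
  function \<open>\<pi> powr (1/4) * (\<Sum>k. h\<^sub>k(s) z\<^sup>k / \<surd>(k!))\<close> of the Hermite functions.
\<close>

definition bargmann_kernel_1 :: "complex \<Rightarrow> real \<Rightarrow> complex" where
  "bargmann_kernel_1 z s = exp (- (of_real s)\<^sup>2 / 2 + of_real (sqrt 2 * s) * z - z\<^sup>2 / 2)"

text \<open>
  The Hermite polynomials are defined by real derivatives; Cauchy's formula needs complex ones.
\<close>

lemma real_gaussian_higher_deriv:
  "of_real ((deriv ^^ k) (\<lambda>r. exp (- r\<^sup>2)) s) = (deriv ^^ k) (\<lambda>z::complex. exp (- z\<^sup>2)) (of_real s)"
proof (induction k arbitrary: s)
  case 0
  thus ?case by (simp add: exp_of_real[symmetric])
next
  case (Suc k)
  let ?f = "(deriv ^^ k) (\<lambda>r::real. exp (- r\<^sup>2))" and ?F = "(deriv ^^ k) (\<lambda>z::complex. exp (- z\<^sup>2))"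
  have "?F holomorphic_on UNIV"
    by (intro holomorphic_higher_deriv holomorphic_intros) auto
  hence F: "(?F has_field_derivative deriv ?F (of_real s)) (at (of_real s))"
    using holomorphic_derivI by blast
  have "((\<lambda>s. ?F (of_real s)) has_vector_derivative deriv ?F (of_real s)) (at s)"
    using F by (rule has_vector_derivative_real_field)
  hence V: "((\<lambda>s. of_real (?f s) :: complex) has_vector_derivative deriv ?F (of_real s)) (at s)"
    by (simp add: Suc.IH)
  have "((\<lambda>s. Re (of_real (?f s))) has_vector_derivative Re (deriv ?F (of_real s))) (at s)"
    using V by (rule bounded_linear.has_vector_derivative[OF bounded_linear_Re])
  hence 1: "deriv ?f s = Re (deriv ?F (of_real s))"
    by (intro DERIV_imp_deriv) (simp add: has_real_derivative_iff_has_vector_derivative)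
  have "((\<lambda>s. Im (of_real (?f s))) has_vector_derivative Im (deriv ?F (of_real s))) (at s)"
    using V by (rule bounded_linear.has_vector_derivative[OF bounded_linear_Im])
  hence "Im (deriv ?F (of_real s)) = 0"
    by (simp add: vector_derivative_const_at vector_derivative_unique_at[OF _ has_vector_derivative_const])
  with 1 show ?case by (simp add: complex_eq_iff)
qed

lemma hermite_normalisation:
  fixes r s :: real
  assumes r: "r > 0"
  shows "(2 ^ k * fact k * sqrt pi) powr (- 1 / 2) * (exp (s\<^sup>2 / 2) * fact k / (r / sqrt 2) ^ k) * exp (- s\<^sup>2 / 2) =
      pi powr (- 1 / 4) * sqrt (fact k) / r ^ k"
proof -
  define \<rho> where "\<rho> = r / sqrt 2"
    have 1: "(2 ^ k * fact k * sqrt pi) powr (- 1 / 2) = 1 / (sqrt 2 ^ k * sqrt (fact k)) * pi powr (- 1 / 4)"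
    proof -
      have "(2 ^ k * fact k * sqrt pi) powr (- 1 / 2) = (2 ^ k * fact k) powr (- 1 / 2) * sqrt pi powr (- 1 / 2)"
        by (simp add: powr_mult)
      also have "sqrt pi powr (- 1 / 2) = pi powr (- 1 / 4)"
        by (simp only: powr_half_sqrt[symmetric] powr_powr pi_ge_zero) simp
      also have "(2 ^ k * fact k) powr (- 1 / 2) = 1 / sqrt (2 ^ k * fact k)"
        using powr_minus_divide[of "2 ^ k * fact k :: real" "1/2"] by (simp add: powr_half_sqrt)
      finally show ?thesis by (simp add: real_sqrt_mult real_sqrt_power)
    qed
    have 3: "exp (s\<^sup>2 / 2) * exp (- s\<^sup>2 / 2) = 1" by (simp flip: exp_add)
    have 4: "\<rho> ^ k * sqrt 2 ^ k = r ^ k" by (simp add: \<rho>_def power_divide)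
    have "(2 ^ k * fact k * sqrt pi) powr (- 1 / 2) * (exp (s\<^sup>2 / 2) * fact k / \<rho> ^ k) * exp (- s\<^sup>2 / 2) =
      (exp (s\<^sup>2 / 2) * exp (- s\<^sup>2 / 2)) * pi powr (- 1 / 4) * fact k / (sqrt (fact k) * (\<rho> ^ k * sqrt 2 ^ k))"
      unfolding 1 times_divide_times_eq by (simp only: mult_ac mult_1_left mult_1_right times_divide_eq_right times_divide_eq_left divide_divide_eq_left)
    also have "\<dots> = pi powr (- 1 / 4) * sqrt (fact k) / r ^ k"
  proof -
    have "fact k / sqrt (fact k) = sqrt (fact k :: real)" by (simp add: real_div_sqrt)
    thus ?thesis unfolding 3 4 by (simp flip: divide_divide_eq_left times_divide_eq_right)
  qed
    finally show ?thesis unfolding \<rho>_def .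
qed

lemma gaussian_eq_bargmann_kernel:
  "exp (- (of_real s + of_real (r / sqrt 2) * c)\<^sup>2) = exp (- (of_real s)\<^sup>2 / 2) * bargmann_kernel_1 (- (of_real r * c)) s"
proof -
  define \<rho> where "\<rho> = r / sqrt 2"
  have "r = sqrt 2 * \<rho>" by (simp add: \<rho>_def)
  hence r: "of_real r = of_real (sqrt 2) * (of_real \<rho> :: complex)" by (metis of_real_mult)
  have s2: "of_real (sqrt 2) * (of_real (sqrt 2) * z) = (2 * z::complex)" for z
    by (simp flip: mult.assoc of_real_mult)
  show ?thesis
    unfolding bargmann_kernel_1_def exp_add[symmetric] \<rho>_def[symmetric] r
    by (intro arg_cong[of _ _ exp]) (simp add: power2_eq_square field_simps s2 s2[of 1, simplified])
qed

text \<open>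
  By Rodrigues' formula \<open>h\<^sub>k(s)\<close> is, up to elementary factors, the \<open>k\<close>-th derivative of the Gaussian
  at \<open>s\<close>. Cauchy's formula expresses it as an integral over the circle of radius \<open>r/\<surd>2\<close> about \<open>s\<close>, and
  on that circle the Gaussian is a constant times the Bargmann kernel at the point \<open>- r exp (2 \<pi> \<i> \<theta>)\<close>.
\<close>

lemma hermite_fun_circle_mean:
  assumes r: "r > 0"
  shows "of_real (hermite_fun k s) =
    of_real (pi powr (- 1 / 4) * sqrt (fact k) / r ^ k) *
    (LINT \<theta>|circle_measure. (- cis (- (2 * pi * \<theta>))) ^ k * bargmann_kernel_1 (- (of_real r * cis (2 * pi * \<theta>))) s)"
proof -
  define \<rho> where "\<rho> = r / sqrt 2"
  have \<rho>: "\<rho> > 0" using r by (simp add: \<rho>_def)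
  define f where "f = (\<lambda>z::complex. exp (- z\<^sup>2))"
  define J where "J = (\<lambda>\<theta>. cis (- (2 * pi * \<theta>)) ^ k * bargmann_kernel_1 (- (of_real r * cis (2 * pi * \<theta>))) s)"
  have contJ: "continuous_on A J" for A
  proof -
    have "continuous_on A (\<lambda>\<theta>. cis (2 * pi * \<theta>))" "continuous_on A (\<lambda>\<theta>. cis (- (2 * pi * \<theta>)))"
      by (rule continuous_on_cis, intro continuous_intros)+
    thus ?thesis unfolding J_def bargmann_kernel_1_def
      by (intro continuous_on_mult continuous_on_power continuous_on_exp continuous_on_add continuous_on_diff
           continuous_on_divide continuous_on_minus continuous_on_const) auto
  qed
  have "((\<lambda>u. f u / (u - of_real s) ^ Suc k) has_contour_integral
      (2 * pi * \<i> / fact k * (deriv ^^ k) f (of_real s))) (circlepath (of_real s) \<rho>)"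
  proof (rule Cauchy_has_contour_integral_higher_derivative_circlepath)
    have "f holomorphic_on UNIV" unfolding f_def by (intro holomorphic_intros)
    thus "f holomorphic_on ball (of_real s) \<rho>" "continuous_on (cball (of_real s) \<rho>) f"
      using holomorphic_on_subset holomorphic_on_imp_continuous_on continuous_on_subset by blast+
    show "of_real s \<in> ball (of_real s :: complex) \<rho>" using \<rho> by simp
  qed
  hence H: "((\<lambda>\<theta>. f (circlepath (of_real s) \<rho> \<theta>) / (circlepath (of_real s) \<rho> \<theta> - of_real s) ^ Suc k *
      vector_derivative (circlepath (of_real s) \<rho>) (at \<theta> within {0..1})) has_integral
      (2 * pi * \<i> / fact k * (deriv ^^ k) f (of_real s))) {0..1}"
    by (simp add: has_contour_integral_def)
  have integrand: "f (circlepath (of_real s) \<rho> \<theta>) / (circlepath (of_real s) \<rho> \<theta> - of_real s) ^ Suc k *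
      vector_derivative (circlepath (of_real s) \<rho>) (at \<theta> within {0..1}) =
      (2 * pi * \<i> * exp (- (of_real s)\<^sup>2 / 2) / of_real (\<rho> ^ k)) * J \<theta>" if "\<theta> \<in> {0..1}" for \<theta>
  proof -
    define c where "c = cis (2 * pi * \<theta>)"
    have c: "exp (2 * of_real pi * \<i> * of_real \<theta>) = c" by (simp add: c_def cis_conv_exp mult_ac)
    have c': "cis (- (2 * pi * \<theta>)) = inverse c" by (simp add: c_def cis_inverse)
    have [simp]: "c \<noteq> 0" by (simp add: c_def)
    have "f (of_real s + of_real \<rho> * c) = exp (- (of_real s)\<^sup>2 / 2) * bargmann_kernel_1 (- (of_real r * c)) s"
      unfolding f_def \<rho>_def by (rule gaussian_eq_bargmann_kernel)
    note k1 = this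
    have k2: "circlepath (of_real s) \<rho> \<theta> = of_real s + of_real \<rho> * c"
      by (simp add: circlepath c)
    have k3: "vector_derivative (circlepath (of_real s) \<rho>) (at \<theta> within {0..1}) = 2 * pi * \<i> * (of_real \<rho> * c)"
      using that by (simp add: vector_derivative_circlepath01 c)
    have k4: "J \<theta> = inverse c ^ k * bargmann_kernel_1 (- (of_real r * c)) s"
      by (simp only: J_def c' c_def)
    have nz: "of_real \<rho> * c \<noteq> 0" using \<rho> by simp
    have "a * b / w ^ Suc k * (d * w) = (d * a) / w ^ k * b" if "w \<noteq> 0" for a b d w :: complex
      using that by simp
    note k5 = this[OF nz]
    show ?thesis unfolding k4 k3 k2 k1 add_diff_cancel_left' k5
      by (simp add: power_mult_distrib inverse_eq_divide power_one_over)
  qed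
  have "((\<lambda>\<theta>. (2 * pi * \<i> * exp (- (of_real s)\<^sup>2 / 2) / of_real (\<rho> ^ k)) * J \<theta>) has_integral
      (2 * pi * \<i> / fact k * (deriv ^^ k) f (of_real s))) {0..1}"
    by (rule has_integral_eq[OF integrand H])
  moreover have "((\<lambda>\<theta>. (2 * pi * \<i> * exp (- (of_real s)\<^sup>2 / 2) / of_real (\<rho> ^ k)) * J \<theta>) has_integral
      (2 * pi * \<i> * exp (- (of_real s)\<^sup>2 / 2) / of_real (\<rho> ^ k)) * integral {0..1} J) {0..1}"
    by (intro has_integral_mult_right integrable_integral integrable_continuous_real contJ)
  ultimately have "2 * pi * \<i> / fact k * (deriv ^^ k) f (of_real s) =
      (2 * pi * \<i> * exp (- (of_real s)\<^sup>2 / 2) / of_real (\<rho> ^ k)) * integral {0..1} J"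
    by (rule has_integral_unique)
  hence "(2 * pi * \<i>) * ((deriv ^^ k) f (of_real s) / fact k) =
      (2 * pi * \<i>) * (exp (- (of_real s)\<^sup>2 / 2) / of_real (\<rho> ^ k) * integral {0..1} J)"
    by simp
  hence "(deriv ^^ k) f (of_real s) / fact k = exp (- (of_real s)\<^sup>2 / 2) / of_real (\<rho> ^ k) * integral {0..1} J"
    by (subst (asm) mult_left_cancel) auto
  hence D: "(deriv ^^ k) f (of_real s) = fact k * (exp (- (of_real s)\<^sup>2 / 2) / of_real (\<rho> ^ k) * integral {0..1} J)"
    by (metis fact_nonzero nonzero_eq_divide_eq mult.commute)
  have J: "integral {0..1} J = integral\<^sup>L circle_measure J"
  proof -
    have [measurable]: "J \<in> borel_measurable borel" by (intro borel_measurable_continuous_onI contJ)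
    show ?thesis
      by (subst integral_circle_measure) (auto intro!: set_borel_integral_eq_integral(2)[symmetric] borel_integrable_atLeastAtMost' contJ)
  qed
  have "of_real (hermite_poly k s) = (- 1) ^ k * of_real (exp (s\<^sup>2)) * (deriv ^^ k) f (of_real s)"
    unfolding hermite_poly_def f_def of_real_mult real_gaussian_higher_deriv by simp
  also have "\<dots> = (- 1) ^ k * of_real (exp (s\<^sup>2 / 2) * fact k / \<rho> ^ k) * integral\<^sup>L circle_measure J"
  proof -
    have "exp (- (of_real s)\<^sup>2 / 2) = (of_real (exp (- s\<^sup>2 / 2)) :: complex)" by (simp flip: exp_of_real)
    moreover have "exp (s\<^sup>2) * exp (- s\<^sup>2 / 2) = exp (s\<^sup>2 / 2)" by (simp flip: exp_add)
    hence "of_real (exp (s\<^sup>2)) * of_real (exp (- s\<^sup>2 / 2)) = (of_real (exp (s\<^sup>2 / 2)) :: complex)"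
      by (simp only: flip: of_real_mult)
    ultimately show ?thesis unfolding D J by (simp add: mult.assoc[symmetric])
  qed
  finally have hp: "of_real (hermite_poly k s) = (- 1) ^ k * of_real (exp (s\<^sup>2 / 2) * fact k / \<rho> ^ k) * integral\<^sup>L circle_measure J" .
  note const = hermite_normalisation[OF r, of k s, folded \<rho>_def]
  have "of_real (hermite_fun k s) = of_real ((2 ^ k * fact k * sqrt pi) powr (- 1 / 2)) * of_real (hermite_poly k s) * (of_real (exp (- s\<^sup>2 / 2)) :: complex)"
    by (simp add: hermite_fun_def)
  also have "\<dots> = of_real ((2 ^ k * fact k * sqrt pi) powr (- 1 / 2) * (exp (s\<^sup>2 / 2) * fact k / \<rho> ^ k) * exp (- s\<^sup>2 / 2)) * ((- 1) ^ k * integral\<^sup>L circle_measure J)"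
    unfolding hp by simp
  also have "\<dots> = of_real (pi powr (- 1 / 4) * sqrt (fact k) / r ^ k) * ((- 1) ^ k * integral\<^sup>L circle_measure J)"
    unfolding const ..
  also have "(- 1) ^ k * integral\<^sup>L circle_measure J = (LINT \<theta>|circle_measure. (- 1) ^ k * J \<theta>)" by simp
  also have "\<dots> = (LINT \<theta>|circle_measure. (- cis (- (2 * pi * \<theta>))) ^ k * bargmann_kernel_1 (- (of_real r * cis (2 * pi * \<theta>))) s)"
    by (intro Bochner_Integration.integral_cong) (auto simp: J_def power_minus[of "cis _"])
  finally show ?thesis .
qed

section \<open>The Bargmann transform and the Fourier transform\<close>

text \<open>
  For imaginary \<open>b\<close> this is the characteristic function of the normal distribution; the real part
  of \<open>b\<close> is absorbed by a translation.
\<close>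

lemma complex_gaussian_integral:
  fixes b :: complex
  shows "integrable lborel (\<lambda>s::real. exp (- (of_real s)\<^sup>2 / 2 + b * of_real s))" (is ?int)
    and "(LINT s|lborel. exp (- (of_real s)\<^sup>2 / 2 + b * of_real (s::real))) = of_real (sqrt (2 * pi)) * exp (b\<^sup>2 / 2)" (is ?eq)
proof -
  define \<beta> \<gamma> where "\<beta> = Re b" and "\<gamma> = Im b"
  have b: "b = of_real \<beta> + \<i> * of_real \<gamma>" by (simp add: \<beta>_def \<gamma>_def complex_eq_iff)
  define g where "g = (\<lambda>s. std_normal_density s *\<^sub>R iexp (\<gamma> * s))"
  have int_g: "integrable lborel g"
  proof (rule Bochner_Integration.integrable_bound)
    show "integrable lborel (std_normal_density :: real \<Rightarrow> real)" by (rule integrable_normal_density) simp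
    show "g \<in> borel_measurable lborel" unfolding g_def by measurable
  qed (simp add: g_def)
  have "(LINT s|std_normal_distribution. iexp (\<gamma> * s)) = of_real (exp (- (\<gamma>\<^sup>2) / 2))"
    using char_std_normal_distribution unfolding char_def by (metis of_real_mult)
  hence I_g: "integral\<^sup>L lborel g = of_real (exp (- (\<gamma>\<^sup>2) / 2))"
    unfolding g_def by (subst (asm) integral_density) (auto simp: normal_density_nonneg)
  have eq: "exp (- (of_real s)\<^sup>2 / 2 + b * of_real s) = (of_real (sqrt (2 * pi)) * exp (b\<^sup>2 / 2 + \<gamma>\<^sup>2 / 2)) * g (- \<beta> + 1 * s)" for s
  proof -
    have "g (- \<beta> + 1 * s) = of_real (1 / sqrt (2 * pi)) * (exp (of_real (- (s - \<beta>)\<^sup>2 / 2)) * exp (\<i> * of_real (\<gamma> * (s - \<beta>))))"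
      unfolding g_def std_normal_density_def exp_of_real scaleR_conv_of_real by simp
    moreover have "exp (b\<^sup>2 / 2 + \<gamma>\<^sup>2 / 2) * (exp (of_real (- (s - \<beta>)\<^sup>2 / 2)) * exp (\<i> * of_real (\<gamma> * (s - \<beta>)))) = exp (- (of_real s)\<^sup>2 / 2 + b * of_real s)"
      unfolding exp_add[symmetric] b by (intro arg_cong[of _ _ exp]) (simp add: power2_eq_square field_simps)
    ultimately show ?thesis by simp
  qed
  show ?int unfolding eq
    by (intro integrable_mult_right lborel_integrable_real_affine int_g) simp
  have "integral\<^sup>L lborel g = (LINT s|lborel. g (- \<beta> + 1 * s))"
    using lborel_integral_real_affine[of 1 g "-\<beta>"] by simp
  hence "(LINT s|lborel. exp (- (of_real s)\<^sup>2 / 2 + b * of_real (s::real))) = (of_real (sqrt (2 * pi)) * exp (b\<^sup>2 / 2 + \<gamma>\<^sup>2 / 2)) * of_real (exp (- (\<gamma>\<^sup>2) / 2))"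
    unfolding eq by (simp add: I_g)
  also have "\<dots> = of_real (sqrt (2 * pi)) * (exp (b\<^sup>2 / 2 + \<gamma>\<^sup>2 / 2) * exp (- (of_real \<gamma>)\<^sup>2 / 2))"
    by (simp flip: exp_of_real)
  also have "exp (b\<^sup>2 / 2 + \<gamma>\<^sup>2 / 2) * exp (- (of_real \<gamma>)\<^sup>2 / 2) = exp (b\<^sup>2 / 2)"
    unfolding exp_add[symmetric] by simp
  finally show ?eq .
qed

lemma integral_lborel_vec_prod:
  fixes g :: "'n::finite \<Rightarrow> real \<Rightarrow> complex"
  assumes "\<And>i. integrable lborel (g i)"
  shows "integrable lborel (\<lambda>x::real^'n. \<Prod>i\<in>UNIV. g i (x $ i))"
    and "(LINT x|(lborel :: (real^'n) measure). (\<Prod>i\<in>UNIV. g i (x $ i))) = (\<Prod>i\<in>UNIV. integral\<^sup>L lborel (g i))"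
proof -
  interpret product_sigma_finite "\<lambda>_::real^'n. lborel :: real measure" ..
  define ax :: "'n \<Rightarrow> real^'n" where "ax = (\<lambda>i. axis i 1)"
  have inj: "inj ax" by (auto simp: ax_def inj_on_def axis_eq_axis)
  have Basis: "(Basis :: (real^'n) set) = range ax" by (auto simp: Basis_vec_def ax_def)
  define G where "G = (\<lambda>b. g (inv ax b))"
  have G: "G (ax i) = g i" for i by (simp add: G_def inv_f_f[OF inj])
  have intG: "integrable lborel (G b)" for b by (simp add: G_def assms)
  have [measurable]: "g i \<in> borel_measurable borel" for i using assms[of i] by (simp add: borel_measurable_integrable)
  have prod: "(\<Prod>i\<in>UNIV. g i ((\<Sum>b\<in>Basis. f b *\<^sub>R b) $ i)) = (\<Prod>b\<in>Basis. G b (f b))" for f :: "real^'n \<Rightarrow> real"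
  proof -
    have "(\<Sum>b\<in>Basis. f b *\<^sub>R b) $ i = f (ax i)" for i
    proof -
      have "(\<Sum>b\<in>Basis. f b *\<^sub>R b) $ i = (\<Sum>b\<in>Basis. f b *\<^sub>R b) \<bullet> ax i"
        by (simp add: ax_def inner_axis)
      also have "\<dots> = f (ax i)" by (subst inner_sum_left_Basis) (auto simp: Basis)
      finally show ?thesis .
    qed
    thus ?thesis by (simp add: Basis prod.reindex[OF inj] G)
  qed
  have m: "(\<lambda>f. \<Sum>b\<in>Basis. f b *\<^sub>R b) \<in> (\<Pi>\<^sub>M b\<in>(Basis :: (real^'n) set). lborel) \<rightarrow>\<^sub>M (borel :: (real^'n) measure)"
    by measurable
  show "integrable lborel (\<lambda>x::real^'n. \<Prod>i\<in>UNIV. g i (x $ i))"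
  proof (subst lborel_eq, subst integrable_distr_eq[OF m])
    show "integrable (\<Pi>\<^sub>M b\<in>(Basis :: (real^'n) set). lborel) (\<lambda>f. \<Prod>i\<in>UNIV. g i ((\<Sum>b\<in>Basis. f b *\<^sub>R b) $ i))"
      unfolding prod by (intro product_integrable_prod intG) auto
  qed measurable
  show "(LINT x|(lborel :: (real^'n) measure). (\<Prod>i\<in>UNIV. g i (x $ i))) = (\<Prod>i\<in>UNIV. integral\<^sup>L lborel (g i))"
  proof (subst lborel_eq, subst integral_distr[OF m])
    show "(LINT f|(\<Pi>\<^sub>M b\<in>(Basis :: (real^'n) set). lborel). (\<Prod>i\<in>UNIV. g i ((\<Sum>b\<in>Basis. f b *\<^sub>R b) $ i))) =
        (\<Prod>i\<in>UNIV. integral\<^sup>L lborel (g i))"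
      unfolding prod by (subst product_integral_prod) (simp_all add: intG Basis prod.reindex[OF inj] G)
  qed measurable
qed

lemma bargmann_kernel_1_eq: "bargmann_kernel_1 z s = exp (- (z\<^sup>2 / 2)) * exp (- (of_real s)\<^sup>2 / 2 + (of_real (sqrt 2) * z) * of_real s)"
  unfolding bargmann_kernel_1_def exp_add[symmetric] by (intro arg_cong[of _ _ exp]) (simp add: algebra_simps)

lemma continuous_on_bargmann_kernel_1 [continuous_intros]:
  assumes "continuous_on A f" "continuous_on A g"
  shows "continuous_on A (\<lambda>x. bargmann_kernel_1 (f x) (g x))"
  unfolding bargmann_kernel_1_def
  by (intro continuous_on_mult continuous_on_power continuous_on_exp continuous_on_add continuous_on_diff
           continuous_on_divide continuous_on_minus continuous_on_const continuous_on_of_real assms) auto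

lemma norm_bargmann_kernel_1:
  "norm (bargmann_kernel_1 z s) = exp (- s\<^sup>2 / 2 + sqrt 2 * s * Re z - (Re z)\<^sup>2 / 2 + (Im z)\<^sup>2 / 2)"
  unfolding bargmann_kernel_1_def norm_exp_eq_Re
  by (intro arg_cong[of _ _ exp]) (simp add: power2_eq_square diff_divide_distrib)

lemma norm_bargmann_kernel_1_le: "norm (bargmann_kernel_1 z s) \<le> exp ((norm z)\<^sup>2 / 2)"
proof -
  have "(s - sqrt 2 * Re z)\<^sup>2 = s\<^sup>2 - 2 * (sqrt 2 * s * Re z) + 2 * (Re z)\<^sup>2"
    by (simp add: power2_diff power_mult_distrib)
  hence "- s\<^sup>2 / 2 + sqrt 2 * s * Re z - (Re z)\<^sup>2 / 2 + (Im z)\<^sup>2 / 2 = ((norm z)\<^sup>2 - (s - sqrt 2 * Re z)\<^sup>2) / 2"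
    by (simp add: cmod_power2 field_simps)
  also have "\<dots> \<le> (norm z)\<^sup>2 / 2" by simp
  finally show ?thesis by (simp add: norm_bargmann_kernel_1)
qed

definition bargmann_kernel :: "('n::finite \<Rightarrow> complex) \<Rightarrow> real ^ 'n \<Rightarrow> complex" where
  "bargmann_kernel z x = (\<Prod>i\<in>UNIV. bargmann_kernel_1 (z i) (x $ i))"

definition bargmann_transform :: "(real ^ 'n \<Rightarrow> complex) \<Rightarrow> ('n::finite \<Rightarrow> complex) \<Rightarrow> complex" where
  "bargmann_transform f z = (LINT x|lborel. f x * bargmann_kernel z x)"

lemma norm_bargmann_kernel_le: "norm (bargmann_kernel z x) \<le> (\<Prod>i\<in>UNIV. exp ((norm (z i))\<^sup>2 / 2))"
  unfolding bargmann_kernel_def prod_norm[symmetric] by (intro prod_mono) (auto simp: norm_bargmann_kernel_1_le)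

lemma borel_measurable_bargmann_kernel [measurable]: "bargmann_kernel z \<in> borel_measurable borel"
proof -
  have [measurable]: "bargmann_kernel_1 w \<in> borel_measurable borel" for w
    by (intro borel_measurable_continuous_onI continuous_intros)
  show ?thesis unfolding bargmann_kernel_def by measurable
qed

lemma integrable_bargmann_kernel: "integrable lborel (bargmann_kernel z)"
  unfolding bargmann_kernel_def bargmann_kernel_1_eq
  by (intro integral_lborel_vec_prod(1) integrable_mult_right complex_gaussian_integral(1))

lemma square_integrable_bargmann_kernel: "square_integrable (bargmann_kernel z)"
  unfolding square_integrable_def
proof
  show "integrable lborel (\<lambda>x. (norm (bargmann_kernel z x))\<^sup>2)"
  proof (rule Bochner_Integration.integrable_bound)
    show "integrable lborel (\<lambda>x. (\<Prod>i\<in>UNIV. exp ((norm (z i))\<^sup>2 / 2)) * norm (bargmann_kernel z x))"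
      by (intro integrable_mult_right integrable_norm integrable_bargmann_kernel)
    show "AE x in lborel. norm ((norm (bargmann_kernel z x))\<^sup>2) \<le> norm ((\<Prod>i\<in>UNIV. exp ((norm (z i))\<^sup>2 / 2)) * norm (bargmann_kernel z x))"
      using norm_bargmann_kernel_le[of z] by (auto simp: power2_eq_square abs_mult abs_prod intro!: mult_right_mono)
  qed measurable
qed measurable

lemma integrable_mult_square_integrable:
  assumes "square_integrable f" "square_integrable g"
  shows "integrable lborel (\<lambda>x. f x * g x)"
proof (rule Bochner_Integration.integrable_bound)
  have [measurable]: "f \<in> borel_measurable borel" "g \<in> borel_measurable borel"
    using assms by (auto simp: square_integrable_def)
  show "integrable lborel (\<lambda>x. ((norm (f x))\<^sup>2 + (norm (g x))\<^sup>2) / 2)"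
    using assms by (simp add: square_integrable_def)
  show "(\<lambda>x. f x * g x) \<in> borel_measurable lborel" by measurable
  show "AE x in lborel. norm (f x * g x) \<le> norm (((norm (f x))\<^sup>2 + (norm (g x))\<^sup>2) / 2)"
    using sum_squares_bound[of "norm (f _)" "norm (g _)"] by (auto simp: norm_mult field_simps)
qed

lemma integrable_mult_bargmann_kernel:
  "square_integrable f \<Longrightarrow> integrable lborel (\<lambda>x. f x * bargmann_kernel z x)"
  by (intro integrable_mult_square_integrable square_integrable_bargmann_kernel)

text \<open>
  The identity that makes the Bargmann transform suited to Fourier eigenfunctions: on the side of
  the complex variable the Fourier transform is the rotation \<open>z \<mapsto> - \<i> z\<close>.
\<close>

lemma fourier_bargmann_kernel: "fourier_L1 (bargmann_kernel z) y = bargmann_kernel (\<lambda>i. - \<i> * z i) y"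
proof -
  define G where "G = (\<lambda>i s. exp (- ((z i)\<^sup>2 / 2)) * exp (- (of_real s)\<^sup>2 / 2 + (of_real (sqrt 2) * z i - \<i> * of_real (y $ i)) * of_real s))"
  have eq: "bargmann_kernel z x * exp (- \<i> * of_real (x \<bullet> y)) = (\<Prod>i\<in>UNIV. G i (x $ i))" for x
  proof -
    have "exp (- \<i> * of_real (x \<bullet> y)) = (\<Prod>i\<in>UNIV. exp (- \<i> * of_real (x $ i * y $ i)))"
      by (simp add: inner_vec_def sum_distrib_left flip: exp_sum)
    moreover have "bargmann_kernel_1 (z i) (x $ i) * exp (- \<i> * of_real (x $ i * y $ i)) = G i (x $ i)" for i
      unfolding G_def bargmann_kernel_1_def exp_add[symmetric]
      by (intro arg_cong[of _ _ exp]) (simp add: algebra_simps)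
    ultimately show ?thesis by (simp add: bargmann_kernel_def flip: prod.distrib)
  qed
  have int: "integral\<^sup>L lborel (G i) = of_real (sqrt (2 * pi)) * bargmann_kernel_1 (- \<i> * z i) (y $ i)" for i
  proof -
    have "integral\<^sup>L lborel (G i) = of_real (sqrt (2 * pi)) * (exp (- ((z i)\<^sup>2 / 2)) * exp ((of_real (sqrt 2) * z i - \<i> * of_real (y $ i))\<^sup>2 / 2))"
      unfolding G_def integral_mult_right_zero complex_gaussian_integral(2) by simp
    also have "exp (- ((z i)\<^sup>2 / 2)) * exp ((of_real (sqrt 2) * z i - \<i> * of_real (y $ i))\<^sup>2 / 2) = bargmann_kernel_1 (- \<i> * z i) (y $ i)"
    proof -
      have "of_real (sqrt 2) * (of_real (sqrt 2) * w) = (2 * w::complex)" for w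
        by (simp flip: mult.assoc of_real_mult)
      thus ?thesis unfolding bargmann_kernel_1_def exp_add[symmetric]
        by (intro arg_cong[of _ _ exp]) (simp add: power2_eq_square field_simps)
    qed
    finally show ?thesis .
  qed
  have "(LINT x|lborel. bargmann_kernel z x * exp (- \<i> * of_real (x \<bullet> y))) = (\<Prod>i\<in>UNIV. integral\<^sup>L lborel (G i))"
    unfolding eq
  proof (rule integral_lborel_vec_prod(2))
    show "integrable lborel (G i)" for i
      unfolding G_def by (intro integrable_mult_right complex_gaussian_integral(1))
  qed
  also have "\<dots> = of_real (sqrt (2 * pi) ^ CARD('a)) * bargmann_kernel (\<lambda>i. - \<i> * z i) y"
    unfolding int prod.distrib by (simp add: bargmann_kernel_def)
  also have "sqrt (2 * pi) ^ CARD('a) = (2 * pi) powr (real CARD('a) / 2)"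
    by (simp add: powr_half_sqrt[symmetric] powr_realpow[symmetric] powr_powr)
  finally have "fourier_L1 (bargmann_kernel z) y = of_real ((2 * pi) powr (- real CARD('a) / 2) * (2 * pi) powr (real CARD('a) / 2)) * bargmann_kernel (\<lambda>i. - \<i> * z i) y"
    unfolding fourier_L1_def by simp
  also have "(2 * pi) powr (- real CARD('a) / 2) * (2 * pi) powr (real CARD('a) / 2) = 1"
    by (simp flip: powr_add)
  finally show ?thesis by simp
qed

text \<open>
  The multiplication formula \<open>\<integral> F(u) k = \<integral> u F(k)\<close>, with \<open>F(k)\<close> known from \<open>fourier_bargmann_kernel\<close>.
\<close>

lemma fourier_L1_bargmann_multiplication:
  fixes u :: "real ^ 'n \<Rightarrow> complex"
  assumes u: "integrable lborel u"
  shows "(LINT x|lborel. fourier_L1 u x * bargmann_kernel z x) = bargmann_transform u (\<lambda>i. - \<i> * z i)"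
proof -
  define c where "c = (of_real ((2 * pi) powr (- real CARD('n) / 2)) :: complex)"
  let ?F = "\<lambda>x y. u x * (bargmann_kernel z y * exp (- \<i> * of_real (x \<bullet> y)))"
  have [measurable]: "u \<in> borel_measurable borel" using u by (simp add: borel_measurable_integrable)
  have "integrable (lborel \<Otimes>\<^sub>M lborel) (case_prod ?F)"
  proof (rule lborel_pair.Fubini_integrable)
    show "integrable lborel (\<lambda>x. LINT y|lborel. norm (case (x, y) of (x, y) \<Rightarrow> ?F x y))"
      by (simp add: norm_mult integrable_norm u)
    show "AE x in lborel. integrable lborel (\<lambda>y. case (x, y) of (x, y) \<Rightarrow> ?F x y)"
    proof (rule AE_I2)
      fix x :: "real ^ 'n"
      have "integrable lborel (\<lambda>y. bargmann_kernel z y * exp (- \<i> * of_real (x \<bullet> y)))"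
        by (rule Bochner_Integration.integrable_bound[OF integrable_bargmann_kernel[of z]]) (auto simp: norm_mult)
      thus "integrable lborel (\<lambda>y. case (x, y) of (x, y) \<Rightarrow> ?F x y)" by simp
    qed
  qed measurable
  hence e0: "(LINT y|lborel. LINT x|lborel. ?F x y) = (LINT x|lborel. LINT y|lborel. ?F x y)"
    by (rule lborel_pair.Fubini_integral)
  have e1: "fourier_L1 u y * bargmann_kernel z y = c * (LINT x|lborel. ?F x y)" for y
  proof -
    have "(LINT x|lborel. ?F x y) = (LINT x|lborel. bargmann_kernel z y * (u x * exp (- \<i> * of_real (x \<bullet> y))))"
      by (intro Bochner_Integration.integral_cong) (auto simp: mult_ac)
    thus ?thesis unfolding integral_mult_right_zero by (simp add: fourier_L1_def c_def)
  qed
  have e2: "c * (LINT y|lborel. ?F x y) = u x * bargmann_kernel (\<lambda>i. - \<i> * z i) x" for x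
  proof -
    have "c * (LINT y|lborel. ?F x y) = u x * fourier_L1 (bargmann_kernel z) x"
      by (simp add: fourier_L1_def c_def inner_commute)
    thus ?thesis by (simp only: fourier_bargmann_kernel)
  qed
  have "(LINT y|lborel. fourier_L1 u y * bargmann_kernel z y) = (LINT y|lborel. c * (LINT x|lborel. ?F x y))"
    by (simp only: e1)
  also have "\<dots> = c * (LINT y|lborel. LINT x|lborel. ?F x y)" by (rule integral_mult_right_zero)
  also have "\<dots> = c * (LINT x|lborel. LINT y|lborel. ?F x y)" by (simp only: e0)
  also have "\<dots> = (LINT x|lborel. c * (LINT y|lborel. ?F x y))" by (rule integral_mult_right_zero[symmetric])
  also have "\<dots> = bargmann_transform u (\<lambda>i. - \<i> * z i)" by (simp only: e2 bargmann_transform_def)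
  finally show ?thesis .
qed

lemma integral_mult_tendsto_L2:
  fixes u :: "nat \<Rightarrow> real ^ 'n \<Rightarrow> complex"
  assumes conv: "L2_converges u f" and k: "square_integrable k"
    and meas [measurable]: "\<And>n. u n \<in> borel_measurable lborel" "f \<in> borel_measurable lborel"
    and int: "\<And>n. integrable lborel (\<lambda>x. u n x * k x)" "integrable lborel (\<lambda>x. f x * k x)"
  shows "(\<lambda>n. LINT x|lborel. u n x * k x) \<longlonglongrightarrow> (LINT x|lborel. f x * k x)"
proof -
  define N where "N = (\<integral>\<^sup>+x. ennreal ((norm (k x))\<^sup>2) \<partial>lborel)"
  define D where "D = (\<lambda>n. \<integral>\<^sup>+x. ennreal ((norm (u n x - f x))\<^sup>2) \<partial>lborel)"
  have [measurable]: "k \<in> borel_measurable borel" using k by (simp add: square_integrable_def)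
  have N: "N < \<infinity>" using k unfolding square_integrable_def N_def integrable_iff_bounded by simp
  have D: "D \<longlonglongrightarrow> 0" using conv by (simp add: L2_converges_def D_def)
  have le: "ennreal ((norm ((LINT x|lborel. u n x * k x) - (LINT x|lborel. f x * k x)))\<^sup>2) \<le> D n * N" for n
  proof -
    have "(LINT x|lborel. u n x * k x) - (LINT x|lborel. f x * k x) = (LINT x|lborel. (u n x - f x) * k x)"
      using int by (simp add: left_diff_distrib)
    moreover have "integrable lborel (\<lambda>x. (u n x - f x) * k x)" using int by (simp add: left_diff_distrib)
    ultimately have "ennreal (norm ((LINT x|lborel. u n x * k x) - (LINT x|lborel. f x * k x))) \<le>
        (\<integral>\<^sup>+x. ennreal (norm (u n x - f x)) * ennreal (norm (k x)) \<partial>lborel)"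
      using integral_norm_bound_ennreal[of lborel "\<lambda>x. (u n x - f x) * k x"] by (simp add: norm_mult ennreal_mult)
    hence "(ennreal (norm ((LINT x|lborel. u n x * k x) - (LINT x|lborel. f x * k x))))\<^sup>2 \<le>
        (\<integral>\<^sup>+x. ennreal (norm (u n x - f x)) * ennreal (norm (k x)) \<partial>lborel)\<^sup>2"
      by (intro power_mono) auto
    also have "\<dots> \<le> (\<integral>\<^sup>+x. (ennreal (norm (u n x - f x)))\<^sup>2 \<partial>lborel) * (\<integral>\<^sup>+x. (ennreal (norm (k x)))\<^sup>2 \<partial>lborel)"
      by (rule Cauchy_Schwarz_nn_integral) measurable
    finally show ?thesis by (simp add: D_def N_def ennreal_power)
  qed
  have "(\<lambda>n. N * D n) \<longlonglongrightarrow> N * 0"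
    by (rule ennreal_tendsto_cmult[OF _ D]) (use N in auto)
  hence "(\<lambda>n. D n * N) \<longlonglongrightarrow> 0" by (simp add: mult.commute)
  hence "(\<lambda>n. ennreal ((norm ((LINT x|lborel. u n x * k x) - (LINT x|lborel. f x * k x)))\<^sup>2)) \<longlonglongrightarrow> 0"
    by (rule tendsto_sandwich[OF _ _ tendsto_const, rotated 2]) (auto simp: le)
  hence "(\<lambda>n. (norm ((LINT x|lborel. u n x * k x) - (LINT x|lborel. f x * k x)))\<^sup>2) \<longlonglongrightarrow> 0"
    by (subst (asm) tendsto_ennreal_iff[of _ _ 0, simplified ennreal_0]) auto
  hence "(\<lambda>n. sqrt ((norm ((LINT x|lborel. u n x * k x) - (LINT x|lborel. f x * k x)))\<^sup>2)) \<longlonglongrightarrow> sqrt 0"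
    by (rule tendsto_real_sqrt)
  hence "(\<lambda>n. (LINT x|lborel. u n x * k x) - (LINT x|lborel. f x * k x)) \<longlonglongrightarrow> 0"
    by (simp add: tendsto_norm_zero_iff)
  thus ?thesis by (simp add: LIM_zero_iff)
qed

text \<open>
  The Bargmann kernel is square integrable, so both sides are continuous in \<open>L\<^sup>2\<close> and the identity
  passes from the approximating integrable functions to the limit.
\<close>

lemma bargmann_transform_fourier:
  assumes "is_fourier_L2 f g"
  shows "bargmann_transform g z = bargmann_transform f (\<lambda>i. - \<i> * z i)"
proof -
  from assms obtain u where u: "\<And>k. integrable lborel (u k)" "\<And>k. square_integrable (u k)"
      "L2_converges u f" "L2_converges (\<lambda>k. fourier_L1 (u k)) g"
    and sq: "square_integrable f" "square_integrable g"
    unfolding is_fourier_L2_def by blast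
  have [measurable]: "u k \<in> borel_measurable borel" for k using u(1)[of k] by (simp add: borel_measurable_integrable)
  have [measurable]: "f \<in> borel_measurable borel" "g \<in> borel_measurable borel" using sq by (auto simp: square_integrable_def)
  have meas [measurable]: "fourier_L1 (u k) \<in> borel_measurable borel" for k
    unfolding fourier_L1_def by measurable
  have int: "integrable lborel (\<lambda>x. fourier_L1 (u k) x * bargmann_kernel z x)" for k
  proof (rule Bochner_Integration.integrable_bound)
    define c where "c = (2 * pi) powr (- real CARD('a) / 2)"
    show "integrable lborel (\<lambda>x. (c * (LINT x|lborel. norm (u k x))) * norm (bargmann_kernel z x))"
      by (intro integrable_mult_right integrable_norm integrable_bargmann_kernel)
    have "norm (fourier_L1 (u k) x) \<le> c * (LINT x|lborel. norm (u k x))" for x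
    proof -
      have "norm (LINT y|lborel. u k y * exp (- \<i> * of_real (y \<bullet> x))) \<le> (LINT y|lborel. norm (u k y * exp (- \<i> * of_real (y \<bullet> x))))"
        by (rule integral_norm_bound)
      also have "\<dots> = (LINT x|lborel. norm (u k x))" by (simp add: norm_mult)
      finally show ?thesis unfolding fourier_L1_def norm_mult c_def by (intro mult_mono) auto
    qed
    thus "AE x in lborel. norm (fourier_L1 (u k) x * bargmann_kernel z x) \<le> norm ((c * (LINT x|lborel. norm (u k x))) * norm (bargmann_kernel z x))"
      by (auto simp: norm_mult abs_mult c_def intro!: mult_right_mono)
  qed measurable
  have "(\<lambda>k. LINT x|lborel. fourier_L1 (u k) x * bargmann_kernel z x) \<longlonglongrightarrow> bargmann_transform g z"
    unfolding bargmann_transform_def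
    by (rule integral_mult_tendsto_L2[OF u(4) square_integrable_bargmann_kernel])
       (auto simp: meas int integrable_mult_bargmann_kernel sq)
  moreover have "(\<lambda>k. LINT x|lborel. fourier_L1 (u k) x * bargmann_kernel z x) \<longlonglongrightarrow> bargmann_transform f (\<lambda>i. - \<i> * z i)"
    unfolding fourier_L1_bargmann_multiplication[OF u(1)] unfolding bargmann_transform_def
    by (rule integral_mult_tendsto_L2[OF u(3) square_integrable_bargmann_kernel])
       (auto simp: integrable_mult_bargmann_kernel sq u)
  ultimately show ?thesis by (rule LIMSEQ_unique)
qed

section \<open>Growth of the Bargmann transform\<close>

text \<open>
  As a function of \<open>(x, y)\<close>, the left-hand side minus \<open>a x y\<close> is a strictly concave quadratic
  polynomial, since \<open>a < 1\<close>. Its maximum is attained at a point with \<open>x = y\<close>, by symmetry, and equals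
  \<open>(1 - a)/(1 + a) \<xi>\<^sup>2\<close>.
\<close>

lemma bargmann_quadratic_bound:
  fixes a x y \<xi> :: real
  assumes a: "0 < a" "a < 1"
  shows "- x\<^sup>2 / 2 + sqrt 2 * x * \<xi> - \<xi>\<^sup>2 / 2 + (- y\<^sup>2 / 2 + sqrt 2 * y * \<xi> - \<xi>\<^sup>2 / 2) \<le> a * (x * y) + (1 - a) / (1 + a) * \<xi>\<^sup>2"
proof -
  define m q where "m = 1 + a" and "q = (1 - a) / (1 + a)"
  have m: "m > 0" using a by (simp add: m_def)
  have q: "4 * (q + 1) = 8 / m" using m by (simp add: m_def q_def field_simps)
  \<comment> \<open>The two squares below measure the distance to the maximum, in \<open>x + y\<close> and in \<open>x - y\<close>.\<close>
  have "0 \<le> (m * (x + y) - 2 * sqrt 2 * \<xi>)\<^sup>2 / m" using m by simp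
  also have "\<dots> = m * (x + y)\<^sup>2 - 4 * (sqrt 2 * (x + y) * \<xi>) + 4 * (q + 1) * \<xi>\<^sup>2"
  proof -
    have "(m * (x + y) - 2 * sqrt 2 * \<xi>)\<^sup>2 = m * (m * (x + y)\<^sup>2 - 4 * (sqrt 2 * (x + y) * \<xi>)) + 8 * \<xi>\<^sup>2"
      by (simp add: power2_diff power_mult_distrib) (simp add: power2_eq_square algebra_simps)
    thus ?thesis unfolding q using m by (simp add: add_divide_distrib)
  qed
  finally have "0 \<le> m * (x + y)\<^sup>2 - 4 * (sqrt 2 * (x + y) * \<xi>) + 4 * (q + 1) * \<xi>\<^sup>2" .
  moreover have "0 \<le> (1 - a) * (x - y)\<^sup>2" using a by simp
  moreover have "m * (x + y)\<^sup>2 + (1 - a) * (x - y)\<^sup>2 = 2 * x\<^sup>2 + 2 * y\<^sup>2 + 4 * (a * (x * y))"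
    unfolding m_def by (simp add: power2_eq_square algebra_simps)
  moreover have "4 * (sqrt 2 * (x + y) * \<xi>) = 4 * (sqrt 2 * x * \<xi>) + 4 * (sqrt 2 * y * \<xi>)" "4 * (q + 1) * \<xi>\<^sup>2 = 4 * (q * \<xi>\<^sup>2) + 4 * \<xi>\<^sup>2"
    by (simp_all add: algebra_simps)
  ultimately show ?thesis unfolding q_def[symmetric] by linarith
qed

lemma bargmann_kernel_product_bound:
  fixes x y :: "real ^ 'n"
  assumes a: "0 < a" "a < 1"
  shows "norm (bargmann_kernel z x) * norm (bargmann_kernel z y) \<le>
     exp (a * \<bar>x \<bullet> y\<bar>) * (\<Prod>i\<in>UNIV. exp ((1 - a) / (1 + a) * (Re (z i))\<^sup>2 + (Im (z i))\<^sup>2))"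
proof -
  have "norm (bargmann_kernel z x) * norm (bargmann_kernel z y) = (\<Prod>i\<in>UNIV. norm (bargmann_kernel_1 (z i) (x $ i)) * norm (bargmann_kernel_1 (z i) (y $ i)))"
    by (simp add: bargmann_kernel_def prod_norm[symmetric] prod.distrib)
  also have "\<dots> \<le> (\<Prod>i\<in>UNIV. exp (a * (x $ i * y $ i)) * exp ((1 - a) / (1 + a) * (Re (z i))\<^sup>2 + (Im (z i))\<^sup>2))"
  proof (intro prod_mono conjI)
    fix i
    show "norm (bargmann_kernel_1 (z i) (x $ i)) * norm (bargmann_kernel_1 (z i) (y $ i)) \<le> exp (a * (x $ i * y $ i)) * exp ((1 - a) / (1 + a) * (Re (z i))\<^sup>2 + (Im (z i))\<^sup>2)"
      unfolding norm_bargmann_kernel_1 exp_add[symmetric] exp_le_cancel_iff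
      using bargmann_quadratic_bound[OF a, of "x $ i" "Re (z i)" "y $ i"] by linarith
  qed auto
  also have "\<dots> = exp (a * (x \<bullet> y)) * (\<Prod>i\<in>UNIV. exp ((1 - a) / (1 + a) * (Re (z i))\<^sup>2 + (Im (z i))\<^sup>2))"
    by (simp add: prod.distrib inner_vec_def sum_distrib_left exp_sum)
  also have "\<dots> \<le> exp (a * \<bar>x \<bullet> y\<bar>) * (\<Prod>i\<in>UNIV. exp ((1 - a) / (1 + a) * (Re (z i))\<^sup>2 + (Im (z i))\<^sup>2))"
    using a by (intro mult_right_mono prod_nonneg) (auto simp: mult_left_mono)
  finally show ?thesis .
qed

text \<open>
  Only \<open>- \<bar>x \<bullet> y\<bar> \<le> - x \<bullet> y\<close> is used on the weight of \<open>K_int\<close>; after that the coordinates decouple.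
\<close>

lemma bargmann_transform_product_bound:
  fixes f g :: "real ^ 'n \<Rightarrow> complex"
  assumes a: "0 < a" "a < 1" and sq: "square_integrable f" "square_integrable g"
    and K: "K_int a f g < \<infinity>"
  shows "norm (bargmann_transform f z) * norm (bargmann_transform g z) \<le>
    enn2real (K_int a f g) * (\<Prod>i\<in>UNIV. exp ((1 - a) / (1 + a) * (Re (z i))\<^sup>2 + (Im (z i))\<^sup>2))"
proof -
  define P where "P = (\<Prod>i\<in>UNIV. exp ((1 - a) / (1 + a) * (Re (z i))\<^sup>2 + (Im (z i))\<^sup>2))"
  have P: "P \<ge> 0" by (simp add: P_def prod_nonneg)
  let ?k = "bargmann_kernel z"
  have [measurable]: "f \<in> borel_measurable borel" "g \<in> borel_measurable borel" using sq by (auto simp: square_integrable_def)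
  have "ennreal (norm (bargmann_transform f z) * norm (bargmann_transform g z)) \<le>
     (\<integral>\<^sup>+x. norm (f x * ?k x) \<partial>lborel) * (\<integral>\<^sup>+y. norm (g y * ?k y) \<partial>lborel)"
    unfolding bargmann_transform_def ennreal_mult'[OF norm_ge_zero]
    by (intro mult_mono integral_norm_bound_ennreal integrable_mult_bargmann_kernel sq) auto
  also have "\<dots> = (\<integral>\<^sup>+x. \<integral>\<^sup>+y. ennreal (norm (f x * ?k x)) * ennreal (norm (g y * ?k y)) \<partial>lborel \<partial>lborel)"
    by (simp add: nn_integral_cmult nn_integral_multc)
  also have "\<dots> \<le> (\<integral>\<^sup>+x. \<integral>\<^sup>+y. ennreal (norm (f x) * norm (g y) * exp (a * \<bar>x \<bullet> y\<bar>)) * ennreal P \<partial>lborel \<partial>lborel)"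
  proof (intro nn_integral_mono)
    fix x y :: "real ^ 'n"
    have "norm (f x * ?k x) * norm (g y * ?k y) = norm (f x) * norm (g y) * (norm (?k x) * norm (?k y))"
      by (simp add: norm_mult)
    also have "\<dots> \<le> norm (f x) * norm (g y) * (exp (a * \<bar>x \<bullet> y\<bar>) * P)"
      unfolding P_def by (intro mult_left_mono bargmann_kernel_product_bound a) auto
    finally show "ennreal (norm (f x * ?k x)) * ennreal (norm (g y * ?k y)) \<le> ennreal (norm (f x) * norm (g y) * exp (a * \<bar>x \<bullet> y\<bar>)) * ennreal P"
      using P by (simp add: mult.assoc flip: ennreal_mult)
  qed
  also have "\<dots> = K_int a f g * ennreal P"
    unfolding K_int_def by (simp add: nn_integral_multc)
  also have "\<dots> = ennreal (enn2real (K_int a f g) * P)"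
    using K P by (simp add: ennreal_mult)
  finally show ?thesis using P by (simp add: P_def)
qed

text \<open>
  Expanding the exponential gives a power series in \<open>\<zeta>\<close> that converges everywhere, by dominated
  convergence with \<open>\<bar>g\<bar> exp (\<bar>\<zeta>\<bar> \<bar>X\<bar>)\<close> as majorant.
\<close>

lemma exponential_moment_entire:
  fixes g :: "'a \<Rightarrow> complex" and X :: "'a \<Rightarrow> real"
  assumes [measurable]: "X \<in> borel_measurable M"
    and int: "\<And>r. integrable M (\<lambda>x. g x * exp (of_real (r * X x)))"
  shows "(\<lambda>\<zeta>. LINT x|M. g x * exp (\<zeta> * of_real (X x))) holomorphic_on UNIV"
proof -
  define c where "c = (\<lambda>k. LINT x|M. g x * of_real (X x) ^ k / fact k)"
  have [measurable]: "g \<in> borel_measurable M" using int[of 0] by (simp add: borel_measurable_integrable)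
  have sums: "(\<lambda>k. c k * \<zeta> ^ k) sums (LINT x|M. g x * exp (\<zeta> * of_real (X x)))" for \<zeta>
  proof -
    define r where "r = norm \<zeta>"
    define w where "w = (\<lambda>x. norm (g x * exp (of_real (r * X x))) + norm (g x * exp (of_real ((- r) * X x))))"
    have w: "integrable M w" unfolding w_def by (intro Bochner_Integration.integrable_add integrable_norm int)
    have w_ge: "norm (g x) * exp (r * \<bar>X x\<bar>) \<le> w x" for x
      by (cases "X x \<ge> 0") (auto simp: w_def norm_mult)
    have partial: "norm (\<Sum>k<n. g x * (\<zeta> * of_real (X x)) ^ k / fact k) \<le> w x" for n x
    proof -
      have "norm (\<Sum>k<n. g x * (\<zeta> * of_real (X x)) ^ k / fact k) \<le> (\<Sum>k<n. norm (g x) * ((r * \<bar>X x\<bar>) ^ k / fact k))"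
        by (rule order_trans[OF norm_sum]) (simp add: norm_mult norm_divide norm_power r_def)
      also have "\<dots> = norm (g x) * (\<Sum>k<n. (r * \<bar>X x\<bar>) ^ k / fact k)" by (simp add: sum_distrib_left)
      also have "(\<Sum>k<n. (r * \<bar>X x\<bar>) ^ k / fact k) \<le> exp (r * \<bar>X x\<bar>)"
      proof -
        have "(\<lambda>k. (r * \<bar>X x\<bar>) ^ k / fact k) sums exp (r * \<bar>X x\<bar>)"
          using exp_converges[of "r * \<bar>X x\<bar>"] by (simp add: divide_inverse mult.commute scaleR_conv_of_real)
        thus ?thesis using sum_le_suminf[of "\<lambda>k. (r * \<bar>X x\<bar>) ^ k / fact k" "{..<n}"]
          by (auto simp: sums_iff r_def)
      qed
      hence "norm (g x) * (\<Sum>k<n. (r * \<bar>X x\<bar>) ^ k / fact k) \<le> norm (g x) * exp (r * \<bar>X x\<bar>)"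
        by (intro mult_left_mono) auto
      also have "\<dots> \<le> w x" by (rule w_ge)
      finally show ?thesis .
    qed
    have int_term: "integrable M (\<lambda>x. g x * (\<zeta> * of_real (X x)) ^ k / fact k)" for k
    proof (rule Bochner_Integration.integrable_bound[OF Bochner_Integration.integrable_add[OF w w]])
      show "AE x in M. norm (g x * (\<zeta> * of_real (X x)) ^ k / fact k) \<le> norm (w x + w x)"
      proof (rule AE_I2)
        fix x
        have "g x * (\<zeta> * of_real (X x)) ^ k / fact k = (\<Sum>k<Suc k. g x * (\<zeta> * of_real (X x)) ^ k / fact k) - (\<Sum>k<k. g x * (\<zeta> * of_real (X x)) ^ k / fact k)"
          by simp
        also have "norm \<dots> \<le> w x + w x"
          by (rule order_trans[OF norm_triangle_ineq4]) (intro add_mono partial)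
        finally show "norm (g x * (\<zeta> * of_real (X x)) ^ k / fact k) \<le> norm (w x + w x)" by simp
      qed
    qed measurable
    have "(\<lambda>n. LINT x|M. (\<Sum>k<n. g x * (\<zeta> * of_real (X x)) ^ k / fact k)) \<longlonglongrightarrow> (LINT x|M. g x * exp (\<zeta> * of_real (X x)))"
    proof (rule integral_dominated_convergence[OF _ _ w])
      show "AE x in M. (\<lambda>n. \<Sum>k<n. g x * (\<zeta> * of_real (X x)) ^ k / fact k) \<longlonglongrightarrow> g x * exp (\<zeta> * of_real (X x))"
      proof (rule AE_I2)
        fix x
        have "(\<lambda>k. g x * ((\<zeta> * of_real (X x)) ^ k /\<^sub>R fact k)) sums (g x * exp (\<zeta> * of_real (X x)))"
          by (intro sums_mult exp_converges)
        thus "(\<lambda>n. \<Sum>k<n. g x * (\<zeta> * of_real (X x)) ^ k / fact k) \<longlonglongrightarrow> g x * exp (\<zeta> * of_real (X x))"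
          by (simp add: sums_def scaleR_conv_of_real divide_inverse mult_ac)
      qed
    qed (auto simp: partial)
    moreover have "(LINT x|M. (\<Sum>k<n. g x * (\<zeta> * of_real (X x)) ^ k / fact k)) = (\<Sum>k<n. c k * \<zeta> ^ k)" for n
    proof -
      have "(LINT x|M. g x * (\<zeta> * of_real (X x)) ^ k / fact k) = c k * \<zeta> ^ k" for k
      proof -
        have "(LINT x|M. g x * (\<zeta> * of_real (X x)) ^ k / fact k) = (LINT x|M. (g x * of_real (X x) ^ k / fact k) * \<zeta> ^ k)"
          by (intro Bochner_Integration.integral_cong) (auto simp: power_mult_distrib mult_ac)
        thus ?thesis unfolding c_def by (simp only: integral_mult_left_zero)
      qed
      thus ?thesis by (subst Bochner_Integration.integral_sum) (auto simp: int_term)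
    qed
    ultimately show ?thesis by (simp add: sums_def)
  qed
  have "(\<lambda>\<zeta>. LINT x|M. g x * exp (\<zeta> * of_real (X x))) holomorphic_on ball 0 R" for R
    by (rule power_series_holomorphic[of _ _ c]) (simp add: sums)
  hence "(\<lambda>\<zeta>. LINT x|M. g x * exp (\<zeta> * of_real (X x))) field_differentiable at \<zeta>" for \<zeta>
    by (meson holomorphic_on_imp_differentiable_at[OF _ open_ball] mem_ball_0 less_add_one)
  thus ?thesis by (simp add: holomorphic_on_def field_differentiable_at_within)
qed

lemma bargmann_transform_entire:
  fixes f :: "real ^ 'n \<Rightarrow> complex"
  assumes f: "square_integrable f"
  shows "(\<lambda>\<zeta>. bargmann_transform f (z(j := \<zeta>))) holomorphic_on UNIV"
proof -
  have split: "bargmann_kernel (z(j := \<zeta>)) x = exp (- (\<zeta>\<^sup>2 / 2)) * (bargmann_kernel (z(j := 0)) x * exp (\<zeta> * of_real (sqrt 2 * x $ j)))" for x \<zeta>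
  proof -
    have "bargmann_kernel_1 \<zeta> (x $ j) = exp (- (\<zeta>\<^sup>2 / 2)) * (bargmann_kernel_1 0 (x $ j) * exp (\<zeta> * of_real (sqrt 2 * x $ j)))"
      unfolding bargmann_kernel_1_def exp_add[symmetric] by (intro arg_cong[of _ _ exp]) (simp add: algebra_simps)
    moreover have "bargmann_kernel (z(j := \<zeta>)) x = bargmann_kernel_1 \<zeta> (x $ j) * (\<Prod>i\<in>UNIV - {j}. bargmann_kernel_1 (z i) (x $ i))" for \<zeta>
      unfolding bargmann_kernel_def by (subst prod.remove[of _ j]) (auto intro!: prod.cong)
    ultimately show ?thesis by simp
  qed
  have "(\<lambda>\<zeta>. LINT x|lborel. (f x * bargmann_kernel (z(j := 0)) x) * exp (\<zeta> * of_real (sqrt 2 * x $ j))) holomorphic_on UNIV"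
  proof (rule exponential_moment_entire)
    fix r :: real
    have "integrable lborel (\<lambda>x. exp ((of_real r)\<^sup>2 / 2) * (f x * bargmann_kernel (z(j := of_real r)) x))"
      by (intro integrable_mult_right integrable_mult_bargmann_kernel f)
    moreover have "exp ((of_real r)\<^sup>2 / 2) * (f x * bargmann_kernel (z(j := of_real r)) x) = f x * bargmann_kernel (z(j := 0)) x * exp (of_real (r * (sqrt 2 * x $ j)))" for x
    proof -
      have "exp ((of_real r)\<^sup>2 / 2) * exp (- ((of_real r)\<^sup>2 / 2)) = (1::complex)" by (simp flip: exp_add)
      hence "exp ((of_real r)\<^sup>2 / 2) * (exp (- ((of_real r)\<^sup>2 / 2)) * w) = w" for w :: complex
        by (simp flip: mult.assoc)
      thus ?thesis unfolding split[of "of_real r"] by (simp add: mult.left_commute mult.assoc)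
    qed
    ultimately show "integrable lborel (\<lambda>x. f x * bargmann_kernel (z(j := 0)) x * exp (of_real (r * (sqrt 2 * x $ j))))" by simp
  qed measurable
  hence "(\<lambda>\<zeta>. exp (- (\<zeta>\<^sup>2 / 2)) * (LINT x|lborel. (f x * bargmann_kernel (z(j := 0)) x) * exp (\<zeta> * of_real (sqrt 2 * x $ j)))) holomorphic_on UNIV"
    by (intro holomorphic_intros) auto
  moreover have "bargmann_transform f (z(j := \<zeta>)) = exp (- (\<zeta>\<^sup>2 / 2)) * (LINT x|lborel. (f x * bargmann_kernel (z(j := 0)) x) * exp (\<zeta> * of_real (sqrt 2 * x $ j)))" for \<zeta>
  proof -
    have "f x * bargmann_kernel (z(j := \<zeta>)) x = exp (- (\<zeta>\<^sup>2 / 2)) * ((f x * bargmann_kernel (z(j := 0)) x) * exp (\<zeta> * of_real (sqrt 2 * x $ j)))" for x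
      by (simp only: split[of \<zeta>] mult_ac)
    thus ?thesis unfolding bargmann_transform_def by (simp only: integral_mult_right_zero)
  qed
  ultimately show ?thesis by simp
qed

section \<open>Hermite coefficients as torus means\<close>

lemma borel_measurable_bargmann_kernel_1 [measurable (raw)]:
  assumes [measurable]: "f \<in> borel_measurable M" "g \<in> borel_measurable M"
  shows "(\<lambda>x. bargmann_kernel_1 (f x) (g x)) \<in> borel_measurable M"
  by (rule borel_measurable_continuous_Pair[where H=bargmann_kernel_1])
     (use assms in \<open>auto intro!: continuous_on_bargmann_kernel_1 continuous_on_fst continuous_on_snd continuous_on_id\<close>)

lemma borel_measurable_cis [measurable (raw)]:
  assumes [measurable]: "f \<in> borel_measurable M"
  shows "(\<lambda>x. cis (f x)) \<in> borel_measurable M"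
proof -
  have [measurable]: "cis \<in> borel_measurable borel"
    by (intro borel_measurable_continuous_onI continuous_on_cis continuous_on_id)
  show ?thesis by measurable
qed

lemma borel_measurable_vec_component [measurable (raw)]:
  fixes f :: "'a \<Rightarrow> real ^ 'n"
  assumes [measurable]: "f \<in> borel_measurable M"
  shows "(\<lambda>x. f x $ i) \<in> borel_measurable M"
proof -
  have [measurable]: "(\<lambda>x::real^'n. x $ i) \<in> borel_measurable borel"
    by (intro borel_measurable_continuous_onI continuous_intros)
  show ?thesis by measurable
qed

text \<open>
  A majorant that is uniform on circles \<open>\<bar>z\<bar> = r\<close>, as needed to exchange the integrals over the torus
  and over \<open>\<real>\<^sup>n\<close>.
\<close>

lemma norm_bargmann_kernel_1_gaussian:
  "norm (bargmann_kernel_1 z s) \<le> exp (3 * (norm z)\<^sup>2) * exp (- (s\<^sup>2 / 4))"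
proof -
  have "0 \<le> (s / 2 - sqrt 2 * Re z)\<^sup>2" by simp
  hence "sqrt 2 * s * Re z \<le> s\<^sup>2 / 4 + 2 * (Re z)\<^sup>2"
    by (simp add: power2_diff power_mult_distrib power_divide algebra_simps)
  moreover have "(norm z)\<^sup>2 = (Re z)\<^sup>2 + (Im z)\<^sup>2" by (rule cmod_power2)
  moreover have "0 \<le> (Re z)\<^sup>2" "0 \<le> (Im z)\<^sup>2" by auto
  ultimately have "- s\<^sup>2 / 2 + sqrt 2 * s * Re z - (Re z)\<^sup>2 / 2 + (Im z)\<^sup>2 / 2 \<le> 3 * (norm z)\<^sup>2 + - (s\<^sup>2 / 4)"
    by linarith
  thus ?thesis unfolding norm_bargmann_kernel_1 exp_add[symmetric] exp_le_cancel_iff .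
qed

lemma square_integrable_vec_gaussian:
  "square_integrable (\<lambda>x::real^'n. \<Prod>i\<in>UNIV. of_real (exp (- ((x $ i)\<^sup>2 / 4))))"
  unfolding square_integrable_def
proof
  let ?g = "\<lambda>s::real. of_real (exp (- (1/2) * (s - 0)\<^sup>2)) :: complex"
  have "integrable lborel (\<lambda>x::real^'n. \<Prod>i\<in>UNIV. ?g (x $ i))"
    by (intro integral_lborel_vec_prod(1) integrable_of_real gaussian_integral_real(1)) auto
  hence "integrable lborel (\<lambda>x::real^'n. norm (\<Prod>i\<in>UNIV. ?g (x $ i)))" by (rule integrable_norm)
  also have "(\<lambda>x::real^'n. norm (\<Prod>i\<in>UNIV. ?g (x $ i))) = (\<lambda>x. (norm (\<Prod>i\<in>UNIV. of_real (exp (- ((x $ i)\<^sup>2 / 4)) ) :: complex))\<^sup>2)"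
  proof
    fix x :: "real ^ 'n"
    have "(exp (- (s\<^sup>2 / 4)))\<^sup>2 = exp (- (1/2) * (s - 0)\<^sup>2)" for s :: real
      by (simp add: power2_eq_square flip: exp_add)
    thus "norm (\<Prod>i\<in>UNIV. ?g (x $ i)) = (norm (\<Prod>i\<in>UNIV. of_real (exp (- ((x $ i)\<^sup>2 / 4))) :: complex))\<^sup>2"
      by (simp add: prod_norm[symmetric] prod_power_distrib)
  qed
  finally show "integrable lborel (\<lambda>x::real^'n. (norm (\<Prod>i\<in>UNIV. of_real (exp (- ((x $ i)\<^sup>2 / 4))) :: complex))\<^sup>2)" .
qed measurable

lemma hermite_coeff_torus_mean:
  fixes f :: "real ^ 'n \<Rightarrow> complex" and r :: "'n \<Rightarrow> real"
  assumes f: "square_integrable f" and r: "\<And>i. r i > 0"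
  shows "hermite_coeff f \<alpha> =
    (\<Prod>i\<in>UNIV. of_real (pi powr (- 1 / 4) * sqrt (fact (\<alpha> $ i)) / r i ^ (\<alpha> $ i))) *
    (LINT \<theta>|(\<Pi>\<^sub>M i\<in>UNIV. circle_measure). (\<Prod>i\<in>UNIV. (- cis (- (2 * pi * \<theta> i))) ^ (\<alpha> $ i)) *
       bargmann_transform f (\<lambda>i. - (of_real (r i) * cis (2 * pi * \<theta> i))))"
proof -
  interpret prob_space circle_measure by (rule prob_space_circle_measure)
  interpret product_prob_space "\<lambda>_::'n. circle_measure" UNIV by unfold_locales
  let ?P = "\<Pi>\<^sub>M i\<in>(UNIV::'n set). circle_measure"
  interpret pair_sigma_finite lborel ?P by unfold_locales
  define C where "C = (\<Prod>i\<in>UNIV. of_real (pi powr (- 1 / 4) * sqrt (fact (\<alpha> $ i)) / r i ^ (\<alpha> $ i)) :: complex)"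
  define T where "T = (\<lambda>\<theta>::'n\<Rightarrow>real. \<Prod>i\<in>UNIV. (- cis (- (2 * pi * \<theta> i))) ^ (\<alpha> $ i))"
  define w where "w = (\<lambda>\<theta> i. - (of_real (r i) * cis (2 * pi * \<theta> i)))"
  have normT: "norm (T \<theta>) = 1" for \<theta> by (simp add: T_def prod_norm[symmetric] norm_power)
  have [measurable]: "f \<in> borel_measurable borel" using f by (simp add: square_integrable_def)
  define F where "F = (\<lambda>x \<theta>. f x * (T \<theta> * bargmann_kernel (w \<theta>) x))"
  have Phi: "of_real (hermite_Phi \<alpha> x) = C * (LINT \<theta>|?P. T \<theta> * bargmann_kernel (w \<theta>) x)" for x :: "real ^ 'n"
  proof -
    let ?g = "\<lambda>i t. (- cis (- (2 * pi * t))) ^ (\<alpha> $ i) * bargmann_kernel_1 (- (of_real (r i) * cis (2 * pi * t))) (x $ i)"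
    have int: "integrable circle_measure (?g i)" for i
    proof (rule integrable_circle_measure_continuous)
      have "continuous_on UNIV (\<lambda>t. cis (2 * pi * t))" "continuous_on UNIV (\<lambda>t. cis (- (2 * pi * t)))"
        by (rule continuous_on_cis, intro continuous_intros)+
      thus "continuous_on UNIV (?g i)"
        by (intro continuous_on_mult continuous_on_power continuous_on_bargmann_kernel_1 continuous_on_minus continuous_on_const)
    qed
    have "of_real (hermite_Phi \<alpha> x) = (\<Prod>i\<in>UNIV. of_real (pi powr (- 1 / 4) * sqrt (fact (\<alpha> $ i)) / r i ^ (\<alpha> $ i)) * integral\<^sup>L circle_measure (?g i))"
      unfolding hermite_Phi_def of_real_prod using r by (intro prod.cong refl hermite_fun_circle_mean)
    also have "\<dots> = C * (\<Prod>i\<in>UNIV. integral\<^sup>L circle_measure (?g i))" by (simp only: prod.distrib C_def)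
    also have "(\<Prod>i\<in>UNIV. integral\<^sup>L circle_measure (?g i)) = (LINT \<theta>|?P. (\<Prod>i\<in>UNIV. ?g i (\<theta> i)))"
      by (rule product_integral_prod[symmetric]) (auto intro: int)
    also have "\<dots> = (LINT \<theta>|?P. T \<theta> * bargmann_kernel (w \<theta>) x)"
      by (simp add: T_def w_def bargmann_kernel_def prod.distrib)
    finally show ?thesis .
  qed
  define B where "B = (\<Prod>i\<in>UNIV. exp (3 * (r i)\<^sup>2))"
  define G where "G = (\<lambda>x::real^'n. B * norm (f x * (\<Prod>i\<in>UNIV. of_real (exp (- ((x $ i)\<^sup>2 / 4))))))"
  have intG: "integrable lborel G" unfolding G_def
    by (intro integrable_mult_right integrable_norm integrable_mult_square_integrable f square_integrable_vec_gaussian)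
  have F_le: "norm (F x \<theta>) \<le> G x" for x \<theta>
  proof -
    have "norm (bargmann_kernel (w \<theta>) x) \<le> (\<Prod>i\<in>UNIV. exp (3 * (r i)\<^sup>2) * exp (- ((x $ i)\<^sup>2 / 4)))"
      unfolding bargmann_kernel_def prod_norm[symmetric]
    proof (intro prod_mono conjI)
      fix i
      have "norm (w \<theta> i) = r i" using r[of i] by (simp add: w_def norm_mult)
      thus "norm (bargmann_kernel_1 (w \<theta> i) (x $ i)) \<le> exp (3 * (r i)\<^sup>2) * exp (- ((x $ i)\<^sup>2 / 4))"
        using norm_bargmann_kernel_1_gaussian[of "w \<theta> i" "x $ i"] by simp
    qed auto
    hence "norm (f x) * norm (bargmann_kernel (w \<theta>) x) \<le> norm (f x) * (B * (\<Prod>i\<in>UNIV. exp (- ((x $ i)\<^sup>2 / 4))))"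
      by (intro mult_left_mono) (auto simp: prod.distrib B_def)
    thus ?thesis by (simp add: F_def G_def norm_mult normT prod_norm[symmetric] mult_ac)
  qed
  have Fm [measurable]: "case_prod F \<in> borel_measurable (lborel \<Otimes>\<^sub>M ?P)"
    unfolding F_def T_def w_def bargmann_kernel_def by measurable
  have Fm2: "F x \<in> borel_measurable ?P" for x
    unfolding F_def T_def w_def bargmann_kernel_def by measurable
  have intF: "integrable ?P (F x)" for x
  proof (rule Bochner_Integration.integrable_bound[of _ "\<lambda>_. G x"])
    show "AE \<theta> in ?P. norm (F x \<theta>) \<le> norm (G x)"
      by (intro AE_I2) (metis F_le abs_ge_self order_trans real_norm_def)
  qed (auto intro: Fm2)
  have "integrable (lborel \<Otimes>\<^sub>M ?P) (case_prod F)"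
  proof (rule Fubini_integrable)
    show "integrable lborel (\<lambda>x. LINT \<theta>|?P. norm (case (x, \<theta>) of (x, \<theta>) \<Rightarrow> F x \<theta>))"
    proof (rule Bochner_Integration.integrable_bound[OF intG])
      show "AE x in lborel. norm (LINT \<theta>|?P. norm (case (x, \<theta>) of (x, \<theta>) \<Rightarrow> F x \<theta>)) \<le> norm (G x)"
      proof (rule AE_I2)
        fix x
        have "(LINT \<theta>|?P. norm (F x \<theta>)) \<le> (LINT \<theta>|?P. G x)"
          by (intro integral_mono integrable_norm intF F_le) auto
        also have "\<dots> = G x" using P.prob_space by simp
        finally show "norm (LINT \<theta>|?P. norm (case (x, \<theta>) of (x, \<theta>) \<Rightarrow> F x \<theta>)) \<le> norm (G x)"
          by simp
      qed
    qed measurable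
    show "AE x in lborel. integrable ?P (\<lambda>\<theta>. case (x, \<theta>) of (x, \<theta>) \<Rightarrow> F x \<theta>)" by (simp add: intF)
  qed measurable
  hence fub: "(LINT \<theta>|?P. LINT x|lborel. F x \<theta>) = (LINT x|lborel. LINT \<theta>|?P. F x \<theta>)" by (rule Fubini_integral)
  have inner: "(LINT x|lborel. F x \<theta>) = T \<theta> * bargmann_transform f (w \<theta>)" for \<theta>
    unfolding F_def bargmann_transform_def by (simp only: mult.left_commute[of "f _" "T \<theta>"] integral_mult_right_zero)
  have "hermite_coeff f \<alpha> = (LINT x|lborel. C * (LINT \<theta>|?P. F x \<theta>))"
    unfolding hermite_coeff_def Phi F_def integral_mult_right_zero
    by (simp only: mult.left_commute[of _ C] integral_mult_right_zero)
  also have "\<dots> = C * (LINT \<theta>|?P. LINT x|lborel. F x \<theta>)" by (simp only: integral_mult_right_zero fub)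
  finally show ?thesis by (simp only: inner C_def T_def w_def)
qed

lemma hermite_coeff_torus_bound:
  fixes f :: "real ^ 'n \<Rightarrow> complex" and r :: "'n \<Rightarrow> real"
  assumes f: "square_integrable f" and r: "\<And>i. r i > 0"
    and b: "\<And>i. continuous_on UNIV (b i)" "\<And>i t. b i t \<ge> 0" and A: "A \<ge> 0"
    and bound: "\<And>\<theta>. norm (bargmann_transform f (\<lambda>i. - (of_real (r i) * cis (2 * pi * \<theta> i)))) \<le> A * (\<Prod>i\<in>UNIV. b i (\<theta> i))"
  shows "norm (hermite_coeff f \<alpha>) \<le> A * (\<Prod>i\<in>UNIV. sqrt (fact (\<alpha> $ i)) / r i ^ (\<alpha> $ i) * integral\<^sup>L circle_measure (b i))"
proof -
  interpret prob_space circle_measure by (rule prob_space_circle_measure)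
  interpret product_prob_space "\<lambda>_::'n. circle_measure" UNIV by unfold_locales
  let ?P = "\<Pi>\<^sub>M i\<in>(UNIV::'n set). circle_measure"
  let ?F = "\<lambda>\<theta>. (\<Prod>i\<in>UNIV. (- cis (- (2 * pi * \<theta> i))) ^ (\<alpha> $ i)) *
       bargmann_transform f (\<lambda>i. - (of_real (r i) * cis (2 * pi * \<theta> i)))"
  have intb: "integrable circle_measure (b i)" for i by (intro integrable_circle_measure_continuous b)
  have int: "integrable ?P (\<lambda>\<theta>. A * (\<Prod>i\<in>UNIV. b i (\<theta> i)))"
    by (intro integrable_mult_right product_integrable_prod intb) auto
  have nF: "norm (?F \<theta>) \<le> A * (\<Prod>i\<in>UNIV. b i (\<theta> i))" for \<theta>
    using bound[of \<theta>] by (simp add: norm_mult norm_power prod_norm[symmetric])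
  have "norm (LINT \<theta>|?P. ?F \<theta>) \<le> (LINT \<theta>|?P. A * (\<Prod>i\<in>UNIV. b i (\<theta> i)))"
  proof (cases "integrable ?P ?F")
    case True
    have "norm (LINT \<theta>|?P. ?F \<theta>) \<le> (LINT \<theta>|?P. norm (?F \<theta>))" by (rule integral_norm_bound)
    also have "\<dots> \<le> (LINT \<theta>|?P. A * (\<Prod>i\<in>UNIV. b i (\<theta> i)))"
      by (intro integral_mono integrable_norm True int nF)
    finally show ?thesis .
  next
    case False
    thus ?thesis using A b by (simp add: not_integrable_integral_eq integral_nonneg_AE prod_nonneg)
  qed
  also have "\<dots> = A * (\<Prod>i\<in>UNIV. integral\<^sup>L circle_measure (b i))"
    by (simp only: integral_mult_right_zero) (subst product_integral_prod, auto intro: intb)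
  finally have le: "norm (LINT \<theta>|?P. ?F \<theta>) \<le> A * (\<Prod>i\<in>UNIV. integral\<^sup>L circle_measure (b i))" .
  have "norm (hermite_coeff f \<alpha>) = (\<Prod>i\<in>UNIV. pi powr (- 1 / 4) * sqrt (fact (\<alpha> $ i)) / r i ^ (\<alpha> $ i)) * norm (LINT \<theta>|?P. ?F \<theta>)"
    unfolding hermite_coeff_torus_mean[of f r \<alpha>, OF f r] norm_mult prod_norm[symmetric] norm_of_real
    using r by (simp add: abs_mult less_imp_le abs_of_nonneg)
  also have "\<dots> \<le> (\<Prod>i\<in>UNIV. sqrt (fact (\<alpha> $ i)) / r i ^ (\<alpha> $ i)) * (A * (\<Prod>i\<in>UNIV. integral\<^sup>L circle_measure (b i)))"
  proof (intro mult_mono le prod_mono conjI prod_nonneg)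
    fix i
    have "pi powr (- 1 / 4) \<le> pi powr 0" using pi_ge_two by (intro powr_mono) auto
    hence "pi powr (- 1 / 4) * sqrt (fact (\<alpha> $ i)) \<le> 1 * sqrt (fact (\<alpha> $ i))" by (intro mult_right_mono) auto
    thus "pi powr (- 1 / 4) * sqrt (fact (\<alpha> $ i)) / r i ^ (\<alpha> $ i) \<le> sqrt (fact (\<alpha> $ i)) / r i ^ (\<alpha> $ i)"
      using r[of i] by (intro divide_right_mono) (auto intro: less_imp_le)
  qed (use r in \<open>auto intro: less_imp_le divide_nonneg_nonneg\<close>)
  finally show ?thesis unfolding prod.distrib by (simp only: mult_ac)
qed

text \<open>
  The product bound at \<open>z\<close> and at \<open>- \<i> z\<close> gives two Gaussian bounds for the same function, with
  \<open>Re z\<close> and \<open>Im z\<close> exchanged. In the variable \<open>z j\<close> they are combined by the Phragmen-Lindelof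
  principle. In the other variables the larger of the two exponents is kept; it falls short of
  \<open>\<bar>z i\<bar>\<^sup>2\<close> away from the coordinate axes, which becomes important after integration over a torus.
\<close>

lemma bargmann_transform_eigen_bound:
  fixes f g :: "real ^ 'n \<Rightarrow> complex"
  assumes sq: "square_integrable f" "square_integrable g"
    and c: "c \<noteq> 0" "\<And>z. bargmann_transform g z = c * bargmann_transform f z"
      "\<And>z. bargmann_transform f (\<lambda>i. - \<i> * z i) = c * bargmann_transform f z"
    and a: "0 < a" "a < 1" and K: "K_int a f g < \<infinity>"
  defines "q \<equiv> (1 - a) / (1 + a)"
  defines "N \<equiv> enn2real (K_int a f g) * max (1 / norm c) (1 / norm c ^ 3)"
  shows "(norm (bargmann_transform f z))\<^sup>2 \<le> N * exp (sqrt q * (norm (z j))\<^sup>2) *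
      (\<Prod>i\<in>UNIV - {j}. exp ((norm (z i))\<^sup>2 - (1 - q) * min ((Re (z i))\<^sup>2) ((Im (z i))\<^sup>2)))"
proof -
  define F where "F = bargmann_transform f"
  define K where "K = enn2real (K_int a f g)"
  have q: "0 < q" "q < 1" using a by (auto simp: q_def)
  have K0: "K \<ge> 0" by (simp add: K_def)
  have nc: "norm c > 0" using c(1) by simp
  have N0: "N \<ge> 0" using K0 by (simp add: N_def K_def le_max_iff_disj)
  have base: "norm c * (norm (F z))\<^sup>2 \<le> K * (\<Prod>i\<in>UNIV. exp (q * (Re (z i))\<^sup>2 + (Im (z i))\<^sup>2))" for z
    using bargmann_transform_product_bound[OF a sq K, of z]
    by (simp add: c(2) F_def K_def q_def norm_mult power2_eq_square mult_ac)
  have b1: "(norm (F z))\<^sup>2 \<le> N * (\<Prod>i\<in>UNIV. exp (q * (Re (z i))\<^sup>2 + (Im (z i))\<^sup>2))" for z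
  proof -
    have "(norm (F z))\<^sup>2 \<le> K * (1 / norm c) * (\<Prod>i\<in>UNIV. exp (q * (Re (z i))\<^sup>2 + (Im (z i))\<^sup>2))"
      using base[of z] nc by (simp add: field_simps)
    also have "\<dots> \<le> N * (\<Prod>i\<in>UNIV. exp (q * (Re (z i))\<^sup>2 + (Im (z i))\<^sup>2))"
      unfolding N_def K_def[symmetric] using K0 by (intro mult_right_mono mult_left_mono prod_nonneg) auto
    finally show ?thesis .
  qed
  have b2: "(norm (F z))\<^sup>2 \<le> N * (\<Prod>i\<in>UNIV. exp ((Re (z i))\<^sup>2 + q * (Im (z i))\<^sup>2))" for z
  proof -
    have "norm c * (norm c * norm (F z))\<^sup>2 \<le> K * (\<Prod>i\<in>UNIV. exp (q * (Im (z i))\<^sup>2 + (Re (z i))\<^sup>2))"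
      using base[of "\<lambda>i. - \<i> * z i"] unfolding F_def c(3) by (simp add: norm_mult)
    hence "(norm (F z))\<^sup>2 \<le> K * (1 / norm c ^ 3) * (\<Prod>i\<in>UNIV. exp ((Re (z i))\<^sup>2 + q * (Im (z i))\<^sup>2))"
      using nc by (simp add: field_simps power2_eq_square power3_eq_cube)
    also have "\<dots> \<le> N * (\<Prod>i\<in>UNIV. exp ((Re (z i))\<^sup>2 + q * (Im (z i))\<^sup>2))"
      unfolding N_def K_def[symmetric] using K0 by (intro mult_right_mono mult_left_mono prod_nonneg) auto
    finally show ?thesis .
  qed
  define R where "R = (\<Prod>i\<in>UNIV - {j}. exp ((norm (z i))\<^sup>2 - (1 - q) * min ((Re (z i))\<^sup>2) ((Im (z i))\<^sup>2)))"
  have R: "R \<ge> 0" by (simp add: R_def prod_nonneg)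
  have le: "q * (Re w)\<^sup>2 + (Im w)\<^sup>2 \<le> (norm w)\<^sup>2 - (1 - q) * min ((Re w)\<^sup>2) ((Im w)\<^sup>2)"
    "(Re w)\<^sup>2 + q * (Im w)\<^sup>2 \<le> (norm w)\<^sup>2 - (1 - q) * min ((Re w)\<^sup>2) ((Im w)\<^sup>2)" for w
  proof -
    have "(1 - q) * min ((Re w)\<^sup>2) ((Im w)\<^sup>2) \<le> (1 - q) * (Re w)\<^sup>2" "(1 - q) * min ((Re w)\<^sup>2) ((Im w)\<^sup>2) \<le> (1 - q) * (Im w)\<^sup>2"
      using q by (auto intro!: mult_left_mono)
    thus "q * (Re w)\<^sup>2 + (Im w)\<^sup>2 \<le> (norm w)\<^sup>2 - (1 - q) * min ((Re w)\<^sup>2) ((Im w)\<^sup>2)"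
      "(Re w)\<^sup>2 + q * (Im w)\<^sup>2 \<le> (norm w)\<^sup>2 - (1 - q) * min ((Re w)\<^sup>2) ((Im w)\<^sup>2)"
      by (simp_all add: cmod_power2 algebra_simps)
  qed
  have split: "(\<Prod>i\<in>UNIV. exp (h ((z(j := \<zeta>)) i))) = exp (h \<zeta>) * (\<Prod>i\<in>UNIV - {j}. exp (h (z i)))" for h :: "complex \<Rightarrow> real" and \<zeta>
    by (subst prod.remove[of _ j]) (auto intro!: prod.cong)
  have "(norm (F (z(j := z j))))\<^sup>2 \<le> (N * R) * exp (sqrt q * (norm (z j))\<^sup>2)"
  proof (rule gaussian_phragmen_lindelof[OF _ q])
    show "(\<lambda>\<zeta>. F (z(j := \<zeta>))) holomorphic_on UNIV" unfolding F_def by (rule bargmann_transform_entire[OF sq(1)])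
    fix \<zeta>
    have "(norm (F (z(j := \<zeta>))))\<^sup>2 \<le> N * (exp (q * (Re \<zeta>)\<^sup>2 + (Im \<zeta>)\<^sup>2) * (\<Prod>i\<in>UNIV - {j}. exp (q * (Re (z i))\<^sup>2 + (Im (z i))\<^sup>2)))"
      using b1[of "z(j := \<zeta>)"] unfolding split[of "\<lambda>w. q * (Re w)\<^sup>2 + (Im w)\<^sup>2"] .
    also have "\<dots> \<le> N * (exp (q * (Re \<zeta>)\<^sup>2 + (Im \<zeta>)\<^sup>2) * R)"
      unfolding R_def by (intro mult_left_mono prod_mono conjI N0) (use le in auto)
    finally show "(norm (F (z(j := \<zeta>))))\<^sup>2 \<le> (N * R) * exp (q * (Re \<zeta>)\<^sup>2 + (Im \<zeta>)\<^sup>2)" by (simp only: mult_ac)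
    have "(norm (F (z(j := \<zeta>))))\<^sup>2 \<le> N * (exp ((Re \<zeta>)\<^sup>2 + q * (Im \<zeta>)\<^sup>2) * (\<Prod>i\<in>UNIV - {j}. exp ((Re (z i))\<^sup>2 + q * (Im (z i))\<^sup>2)))"
      using b2[of "z(j := \<zeta>)"] unfolding split[of "\<lambda>w. (Re w)\<^sup>2 + q * (Im w)\<^sup>2"] .
    also have "\<dots> \<le> N * (exp ((Re \<zeta>)\<^sup>2 + q * (Im \<zeta>)\<^sup>2) * R)"
      unfolding R_def by (intro mult_left_mono prod_mono conjI N0) (use le in auto)
    finally show "(norm (F (z(j := \<zeta>))))\<^sup>2 \<le> (N * R) * exp ((Re \<zeta>)\<^sup>2 + q * (Im \<zeta>)\<^sup>2)" by (simp only: mult_ac)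
  qed
  thus ?thesis by (simp add: F_def R_def mult_ac)
qed

section \<open>Estimate of the coefficients\<close>

lemma min_square_circle_ge:
  "r\<^sup>2 * (sin (4 * pi * \<theta>))\<^sup>2 / 4 \<le> min ((Re (- (of_real r * cis (2 * pi * \<theta>))))\<^sup>2) ((Im (- (of_real r * cis (2 * pi * \<theta>))))\<^sup>2)"
proof -
  define C S where "C = cos (2 * pi * \<theta>)" and "S = sin (2 * pi * \<theta>)"
  have "sin (4 * pi * \<theta>) = 2 * S * C" using sin_double[of "2 * pi * \<theta>"] by (simp add: C_def S_def mult_ac)
  hence "(sin (4 * pi * \<theta>))\<^sup>2 / 4 = S\<^sup>2 * C\<^sup>2" by (simp add: power_mult_distrib)
  moreover have "S\<^sup>2 * C\<^sup>2 \<le> S\<^sup>2" "S\<^sup>2 * C\<^sup>2 \<le> C\<^sup>2"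
    by (simp_all add: C_def S_def mult_left_le mult_left_le_one_le abs_square_le_1)
  ultimately have "r\<^sup>2 * ((sin (4 * pi * \<theta>))\<^sup>2 / 4) \<le> r\<^sup>2 * min (C\<^sup>2) (S\<^sup>2)" by (intro mult_left_mono) auto
  thus ?thesis by (simp add: C_def S_def power_mult_distrib min_mult_distrib_left)
qed

lemma sqrt_cauchy_weight_bound:
  assumes "\<mu> > 0"
  shows "sqrt (fact k) / sqrt ((real k + 1) / \<mu>) ^ k * exp (\<mu> * ((real k + 1) / \<mu>) / 2) \<le> sqrt (exp 1) * sqrt (sqrt (real k + 1)) * sqrt \<mu> ^ k"
proof -
  have "sqrt (fact k) / sqrt ((real k + 1) / \<mu>) ^ k * exp (\<mu> * ((real k + 1) / \<mu>) / 2) = sqrt (fact k * exp (real k + 1) / (real k + 1) ^ k) * sqrt \<mu> ^ k"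
  proof -
    have "exp ((real k + 1) / 2) = sqrt (exp (real k + 1))"
      by (rule real_sqrt_unique[symmetric]) (auto simp: power2_eq_square simp flip: exp_add)
    thus ?thesis using assms by (simp add: real_sqrt_divide real_sqrt_mult real_sqrt_power power_divide)
  qed
  also have "\<dots> \<le> sqrt (exp 1 * sqrt (real k + 1)) * sqrt \<mu> ^ k"
    using assms by (intro mult_right_mono real_sqrt_le_mono cauchy_weight_bound) auto
  finally show ?thesis by (simp add: real_sqrt_mult)
qed

text \<open>
  Cauchy estimate on the torus with squared radii \<open>\<alpha>\<^sub>i + 1\<close> for \<open>i \<noteq> j\<close> and \<open>(\<alpha>\<^sub>j + 1)/\<surd>q\<close>, where
  \<open>q = exp (- 4 t)\<close>. The coordinate \<open>j\<close> contributes the decay \<open>exp (- t \<alpha>\<^sub>j)\<close> and the loss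
  \<open>(\<alpha>\<^sub>j + 1) powr (1/4)\<close>. Each other coordinate would contribute a loss of the same kind, but the mean
  over the circle of the bound for the Bargmann transform is smaller than its maximum by a factor of
  order \<open>1/\<surd>((1 - q) (\<alpha>\<^sub>i + 1))\<close>, so its contribution stays bounded. The bound on that factor depends on a
  lower bound \<open>t0\<close> for \<open>t\<close>.
\<close>

lemma hermite_coeff_coordinate_bound:
  fixes f g :: "real ^ 'n \<Rightarrow> complex" and \<alpha> :: "nat ^ 'n"
  assumes sq: "square_integrable f" "square_integrable g"
    and c: "c \<noteq> 0" "\<And>z. bargmann_transform g z = c * bargmann_transform f z"
      "\<And>z. bargmann_transform f (\<lambda>i. - \<i> * z i) = c * bargmann_transform f z"
    and t: "0 < t0" "t0 \<le> t" and a: "a = tanh (2 * t)" and K: "K_int a f g < \<infinity>"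
  shows "norm (hermite_coeff f \<alpha>) \<le>
    2 * sqrt (max (1 / norm c) (1 / norm c ^ 3)) * (10 / sqrt (1 - exp (- 4 * t0))) ^ (CARD('n) - 1) *
    sqrt (enn2real (K_int a f g)) * (2 * real (\<alpha> $ j) + 1) powr (1 / 4) * exp (- (t * real (\<alpha> $ j)))"
proof -
  define q where "q = exp (- 4 * t)"
  define N where "N = enn2real (K_int a f g) * max (1 / norm c) (1 / norm c ^ 3)"
  have q: "0 < q" "q < 1" "q \<le> exp (- 4 * t0)" using t by (auto simp: q_def)
  have aq: "a = (1 - q) / (1 + q)" by (simp add: a q_def tanh_real_altdef)
  have a01: "0 < a" "a < 1" using q by (auto simp: aq field_simps)
  have qa: "(1 - a) / (1 + a) = q"
  proof -
    have "1 + q \<noteq> 0" using q by linarith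
    hence "1 - a = 2 * q / (1 + q)" "1 + a = 2 / (1 + q)" by (simp_all add: aq field_simps)
    thus ?thesis using \<open>1 + q \<noteq> 0\<close> by simp
  qed
  have N0: "N \<ge> 0" by (simp add: N_def le_max_iff_disj)
  \<comment> \<open>The factor \<open>lam i\<close> is twice the rate of Gaussian growth in the \<open>i\<close>-th variable.\<close>
  define lam where "lam = (\<lambda>i. if i = j then sqrt q else 1)"
  define r where "r = (\<lambda>i. sqrt ((real (\<alpha> $ i) + 1) / lam i))"
  have lam: "lam i > 0" for i using q by (simp add: lam_def)
  have r: "r i > 0" for i using lam[of i] by (simp add: r_def add_nonneg_pos)
  have r2: "(r i)\<^sup>2 = (real (\<alpha> $ i) + 1) / lam i" for i using lam[of i] by (simp add: r_def)
  define \<beta> where "\<beta> = (\<lambda>i. (1 - q) * (r i)\<^sup>2 / 8)"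
  define b where "b = (\<lambda>i t. if i = j then exp (lam i * (r i)\<^sup>2 / 2) else exp (lam i * (r i)\<^sup>2 / 2) * exp (- \<beta> i * (sin (4 * pi * t))\<^sup>2))"
  have bnn: "b i t \<ge> 0" for i t by (simp add: b_def)
  interpret prob_space circle_measure by (rule prob_space_circle_measure)
  have Bj: "sqrt (fact (\<alpha> $ j)) / r j ^ (\<alpha> $ j) * integral\<^sup>L circle_measure (b j) \<le> 2 * (2 * real (\<alpha> $ j) + 1) powr (1 / 4) * exp (- (t * real (\<alpha> $ j)))"
  proof -
    define k where "k = \<alpha> $ j"
    have "sqrt (fact k) / r j ^ k * integral\<^sup>L circle_measure (b j) = sqrt (fact k) / sqrt ((real k + 1) / sqrt q) ^ k * exp (sqrt q * ((real k + 1) / sqrt q) / 2)"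
      using r2[of j] prob_space by (simp add: b_def lam_def r_def k_def)
    also have "\<dots> \<le> sqrt (exp 1) * sqrt (sqrt (real k + 1)) * sqrt (sqrt q) ^ k"
      by (rule sqrt_cauchy_weight_bound) (use q in simp)
    also have "sqrt (sqrt q) ^ k = exp (- (t * real k))"
    proof -
      have 1: "sqrt (exp (2 * x)) = exp x" for x :: real
        by (rule real_sqrt_unique) (auto simp: power2_eq_square simp flip: exp_add)
      have "sqrt (sqrt q) = exp (- t)" using 1[of "- 2 * t"] 1[of "- t"] by (simp add: q_def)
      thus ?thesis by (simp add: mult.commute flip: exp_of_nat_mult)
    qed
    also have "sqrt (exp 1) * sqrt (sqrt (real k + 1)) * exp (- (t * real k)) \<le> 2 * (2 * real k + 1) powr (1 / 4) * exp (- (t * real k))"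
    proof (intro mult_mono)
      show "sqrt (exp 1) \<le> (2::real)" using exp_le by (intro real_le_lsqrt) auto
      have "sqrt (sqrt (real k + 1)) = (real k + 1) powr (1 / 4)" by (simp add: powr_half_sqrt[symmetric] powr_powr)
      also have "\<dots> \<le> (2 * real k + 1) powr (1 / 4)" by (intro powr_mono2) auto
      finally show "sqrt (sqrt (real k + 1)) \<le> (2 * real k + 1) powr (1 / 4)" .
    qed auto
    finally show ?thesis
      by (simp add: k_def)
  qed
  have Bi: "sqrt (fact (\<alpha> $ i)) / r i ^ (\<alpha> $ i) * integral\<^sup>L circle_measure (b i) \<le> 10 / sqrt (1 - exp (- 4 * t0))" if i: "i \<in> UNIV - {j}" for i
  proof -
    define k where "k = \<alpha> $ i"
    have l1: "lam i = 1" using i by (simp add: lam_def)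
    have \<beta>: "\<beta> i = (1 - q) * (real k + 1) / 8" using r2[of i] l1 by (simp add: \<beta>_def k_def)
    have \<beta>0: "\<beta> i > 0" unfolding \<beta> using q by (simp add: add_nonneg_pos)
    have "integral\<^sup>L circle_measure (b i) = exp (1 * ((real k + 1) / 1) / 2) * (LINT t|circle_measure. exp (- \<beta> i * (sin (4 * pi * t))\<^sup>2))"
      using i r2[of i] l1 by (simp add: b_def k_def)
    also have "\<dots> \<le> exp (1 * ((real k + 1) / 1) / 2) * (2 / sqrt (\<beta> i))"
      by (intro mult_left_mono circle_mean_gaussian_sin \<beta>0) auto
    finally have "sqrt (fact k) / r i ^ k * integral\<^sup>L circle_measure (b i) \<le> sqrt (fact k) / r i ^ k * (exp (1 * ((real k + 1) / 1) / 2) * (2 / sqrt (\<beta> i)))"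
      using r[of i] by (intro mult_left_mono) (auto intro: less_imp_le)
    also have "\<dots> = (sqrt (fact k) / sqrt ((real k + 1) / 1) ^ k * exp (1 * ((real k + 1) / 1) / 2)) * (2 / sqrt (\<beta> i))"
      using l1 by (simp add: r_def k_def)
    also have "\<dots> \<le> (sqrt (exp 1) * sqrt (sqrt (real k + 1)) * sqrt 1 ^ k) * (2 / sqrt (\<beta> i))"
      using \<beta>0 by (intro mult_right_mono sqrt_cauchy_weight_bound) auto
    also have "\<dots> \<le> (sqrt 3 * sqrt (real k + 1) * 1) * (2 / sqrt (\<beta> i))"
    proof (intro mult_right_mono mult_mono real_sqrt_le_mono)
      show "sqrt (real k + 1) \<le> real k + 1" by (rule real_le_lsqrt) (auto simp: power2_eq_square algebra_simps)
    qed (use exp_le \<beta>0 in auto)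
    also have "\<dots> = sqrt 3 * (2 * sqrt 8) / sqrt (1 - q)"
    proof -
      have "sqrt (\<beta> i) = sqrt (1 - q) * sqrt (real k + 1) / sqrt 8" unfolding \<beta> by (simp add: real_sqrt_divide real_sqrt_mult)
      moreover have "sqrt (real k + 1) \<noteq> 0" by (simp add: add_nonneg_eq_0_iff)
      ultimately show ?thesis by simp
    qed
    also have "\<dots> \<le> 10 / sqrt (1 - exp (- 4 * t0))"
    proof (intro frac_le real_sqrt_le_mono)
      show "sqrt 3 * (2 * sqrt 8) \<le> (10::real)"
        by (rule power2_le_imp_le) (simp_all add: power_mult_distrib)
    qed (use q t in auto)
    finally show ?thesis
      by (simp add: k_def)
  qed
  have nonneg: "0 \<le> sqrt (fact (\<alpha> $ i)) / r i ^ (\<alpha> $ i) * integral\<^sup>L circle_measure (b i)" for i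
    using r[of i] bnn by (intro mult_nonneg_nonneg divide_nonneg_nonneg integral_nonneg_AE) auto
  have "norm (hermite_coeff f \<alpha>) \<le> sqrt N * (\<Prod>i\<in>UNIV. sqrt (fact (\<alpha> $ i)) / r i ^ (\<alpha> $ i) * integral\<^sup>L circle_measure (b i))"
  proof (rule hermite_coeff_torus_bound[OF sq(1) r])
    show "continuous_on UNIV (b i)" for i by (cases "i = j") (auto simp: b_def intro!: continuous_intros)
    show "sqrt N \<ge> 0" using N0 by simp
    fix \<theta> :: "'n \<Rightarrow> real"
    define z where "z = (\<lambda>i. - (of_real (r i) * cis (2 * pi * \<theta> i)))"
    have nz: "norm (z i) = r i" for i using r[of i] by (simp add: z_def norm_mult)
    have "(norm (bargmann_transform f z))\<^sup>2 \<le> N * exp (sqrt q * (norm (z j))\<^sup>2) *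
      (\<Prod>i\<in>UNIV - {j}. exp ((norm (z i))\<^sup>2 - (1 - q) * min ((Re (z i))\<^sup>2) ((Im (z i))\<^sup>2)))"
      using bargmann_transform_eigen_bound[OF sq c a01 K, of z j] unfolding qa N_def .
    also have "\<dots> \<le> N * exp (sqrt q * (norm (z j))\<^sup>2) * (\<Prod>i\<in>UNIV - {j}. (b i (\<theta> i))\<^sup>2)"
    proof (intro mult_left_mono prod_mono conjI)
      fix i assume i: "i \<in> UNIV - {j}"
      have "(1 - q) * ((r i)\<^sup>2 * (sin (4 * pi * \<theta> i))\<^sup>2 / 4) \<le> (1 - q) * min ((Re (z i))\<^sup>2) ((Im (z i))\<^sup>2)"
        unfolding z_def by (intro mult_left_mono min_square_circle_ge) (use q in auto)
      hence "(norm (z i))\<^sup>2 - (1 - q) * min ((Re (z i))\<^sup>2) ((Im (z i))\<^sup>2) \<le> (r i)\<^sup>2 + 2 * (- \<beta> i * (sin (4 * pi * \<theta> i))\<^sup>2)"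
        by (simp add: nz \<beta>_def)
      hence "exp ((norm (z i))\<^sup>2 - (1 - q) * min ((Re (z i))\<^sup>2) ((Im (z i))\<^sup>2)) \<le> exp ((r i)\<^sup>2 + 2 * (- \<beta> i * (sin (4 * pi * \<theta> i))\<^sup>2))" by simp
      also have "\<dots> = (b i (\<theta> i))\<^sup>2" using i
        by (simp add: b_def lam_def exp_double[symmetric] right_diff_distrib flip: exp_add)
      finally show "exp ((norm (z i))\<^sup>2 - (1 - q) * min ((Re (z i))\<^sup>2) ((Im (z i))\<^sup>2)) \<le> (b i (\<theta> i))\<^sup>2" .
    qed (use N0 in auto)
    also have "\<dots> = N * (\<Prod>i\<in>UNIV. b i (\<theta> i))\<^sup>2"
    proof -
      have "exp (sqrt q * (norm (z j))\<^sup>2) = (b j (\<theta> j))\<^sup>2"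
        by (simp add: b_def lam_def nz power2_eq_square[of "exp _"] flip: exp_add)
      moreover have "(\<Prod>i\<in>UNIV. (b i (\<theta> i))\<^sup>2) = (b j (\<theta> j))\<^sup>2 * (\<Prod>i\<in>UNIV - {j}. (b i (\<theta> i))\<^sup>2)"
        by (rule prod.remove) auto
      ultimately show ?thesis by (simp add: prod_power_distrib)
    qed
    finally have "sqrt ((norm (bargmann_transform f z))\<^sup>2) \<le> sqrt (N * (\<Prod>i\<in>UNIV. b i (\<theta> i))\<^sup>2)"
      by (rule real_sqrt_le_mono)
    thus "norm (bargmann_transform f (\<lambda>i. - (of_real (r i) * cis (2 * pi * \<theta> i)))) \<le> sqrt N * (\<Prod>i\<in>UNIV. b i (\<theta> i))"
      by (simp add: z_def real_sqrt_mult prod_nonneg bnn)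
  qed (rule bnn)
  also have "\<dots> = sqrt N * ((sqrt (fact (\<alpha> $ j)) / r j ^ (\<alpha> $ j) * integral\<^sup>L circle_measure (b j)) *
      (\<Prod>i\<in>UNIV - {j}. sqrt (fact (\<alpha> $ i)) / r i ^ (\<alpha> $ i) * integral\<^sup>L circle_measure (b i)))"
    by (subst prod.remove[of _ j]) auto
  also have "\<dots> \<le> sqrt N * ((2 * (2 * real (\<alpha> $ j) + 1) powr (1 / 4) * exp (- (t * real (\<alpha> $ j)))) * (\<Prod>i\<in>UNIV - {j}. 10 / sqrt (1 - exp (- 4 * t0))))"
    by (intro mult_left_mono mult_mono[OF Bj] prod_mono prod_nonneg conjI Bi) (use N0 nonneg in auto)
  also have "(\<Prod>i\<in>UNIV - {j}. 10 / sqrt (1 - exp (- 4 * t0))) = (10 / sqrt (1 - exp (- 4 * t0))) ^ (CARD('n) - 1)"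
    by (simp add: card_Diff_singleton)
  finally show ?thesis by (simp only: N_def real_sqrt_mult mult_ac)
qed

lemma le_geometric_mean:
  fixes u :: "'n::finite \<Rightarrow> real"
  assumes x: "0 \<le> x" "0 \<le> B" "\<And>i. 0 \<le> u i" "\<And>i. x \<le> B * u i"
  shows "x \<le> B * (\<Prod>i\<in>UNIV. u i powr (1 / real CARD('n)))"
proof -
  let ?n = "real CARD('n)"
  have n: "?n > 0" by simp
  have pw: "(y ^ CARD('n)) powr (1 / ?n) = y" if "y \<ge> 0" for y :: real
    using that n by (cases "y = 0") (auto simp: powr_realpow[symmetric] powr_powr)
  have "x ^ CARD('n) \<le> (\<Prod>i\<in>(UNIV::'n set). B * u i)"
    using prod_mono[of "UNIV :: 'n set" "\<lambda>_. x" "\<lambda>i. B * u i"] x by simp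
  hence "(x ^ CARD('n)) powr (1 / ?n) \<le> (B ^ CARD('n) * (\<Prod>i\<in>UNIV. u i)) powr (1 / ?n)"
    using x by (intro powr_mono2) (auto simp: prod.distrib)
  also have "\<dots> = B * (\<Prod>i\<in>UNIV. u i powr (1 / ?n))"
    using x by (simp add: powr_mult pw prod_powr_distrib)
  finally show ?thesis using x pw by simp
qed

section \<open>Uniformity in the parameter, and the geometric mean\<close>

lemma hermite_coeff_eq_0_if_bargmann_transform_eq_0:
  fixes f :: "real ^ 'n \<Rightarrow> complex"
  assumes "square_integrable f" "\<And>z. bargmann_transform f z = 0"
  shows "hermite_coeff f \<alpha> = 0"
  using hermite_coeff_torus_bound[of f "\<lambda>_. 1" "\<lambda>_ _. 1" 0 \<alpha>] assms by simp

lemma K_int_mono: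
  assumes "a \<le> b"
  shows "K_int a f g \<le> K_int b f g"
  unfolding K_int_def using assms
  by (intro nn_integral_mono ennreal_leI mult_left_mono) (auto intro: mult_right_mono)

text \<open>
  For \<open>a = 0\<close> the double integral factorises into the two \<open>L\<^sup>1\<close> norms.
\<close>

lemma bargmann_transform_eq_0_if_K_int_0:
  fixes f g :: "real ^ 'n \<Rightarrow> complex"
  assumes sq: "square_integrable f" "square_integrable g" and K: "K_int 0 f g = 0"
  shows "(\<forall>z. bargmann_transform f z = 0) \<or> (\<forall>z. bargmann_transform g z = 0)"
proof -
  have [measurable]: "f \<in> borel_measurable borel" "g \<in> borel_measurable borel" using sq by (auto simp: square_integrable_def)
  have "K_int 0 f g = (\<integral>\<^sup>+x. ennreal (norm (f x)) \<partial>lborel) * (\<integral>\<^sup>+y. ennreal (norm (g y)) \<partial>lborel)"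
    unfolding K_int_def by (simp add: ennreal_mult nn_integral_cmult nn_integral_multc)
  moreover have zero: "bargmann_transform h z = 0" if "(\<integral>\<^sup>+x. ennreal (norm (h x)) \<partial>lborel) = 0" and [measurable]: "h \<in> borel_measurable borel"
    for h :: "real ^ 'n \<Rightarrow> complex" and z
  proof -
    have "AE x in lborel. h x = 0" using that by (subst (asm) nn_integral_0_iff_AE) auto
    hence "AE x in lborel. h x * bargmann_kernel z x = 0" by eventually_elim simp
    thus ?thesis unfolding bargmann_transform_def by (rule integral_eq_zero_AE)
  qed
  ultimately show ?thesis using K zero[of f] zero[of g] by auto
qed

theorem theorem2p9:
  fixes f fhat :: "real ^ 'n \<Rightarrow> complex"
  assumes "fourier_eigenfunction f"
    and "is_fourier_L2 f fhat"
  shows "\<exists>C::real. C > 0 \<and>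
    (\<forall>(a::real) (t::real) (\<alpha> :: nat ^ 'n).
       0 < a \<longrightarrow> a < 1 \<longrightarrow> K_int a f fhat < \<infinity> \<longrightarrow> t > 0 \<longrightarrow> a = tanh (2 * t) \<longrightarrow>
       norm (hermite_coeff f \<alpha>) \<le>
         C * exp (t / 2) * sqrt (enn2real (K_int a f fhat)) *
         (\<Prod>j\<in>UNIV. (2 * real (\<alpha> $ j) + 1) powr (1 / (4 * real CARD('n)))) *
         exp (- ((2 * real (\<Sum>j\<in>UNIV. \<alpha> $ j) + real CARD('n)) * t / (2 * real CARD('n)))))"
proof -
  have sq: "square_integrable f" "square_integrable fhat" using assms(2) by (auto simp: is_fourier_L2_def)
  obtain c where c: "is_fourier_L2 f (\<lambda>x. c * f x)" using assms(1) by (auto simp: fourier_eigenfunction_def)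
  have eig: "bargmann_transform f (\<lambda>i. - \<i> * z i) = c * bargmann_transform f z" for z
    using bargmann_transform_fourier[OF c, of z] by (simp add: bargmann_transform_def mult.assoc)
  have hat: "bargmann_transform fhat z = c * bargmann_transform f z" for z
    using bargmann_transform_fourier[OF assms(2), of z] eig by simp
  let ?n = "real CARD('n)"
  have n: "?n > 0" by simp
  \<comment> \<open>It suffices to bound the coefficient by the decay in each single coordinate: the geometric mean
      of these \<open>n\<close> bounds is the claim, since \<open>exp (t/2)\<close> cancels the part \<open>n t / (2 n)\<close> of the exponent.\<close>
  have reduce: ?thesis if C: "C > 0" and
    coord: "\<And>t (\<alpha> :: nat ^ 'n) j. t > 0 \<Longrightarrow> K_int (tanh (2 * t)) f fhat < \<infinity> \<Longrightarrow> norm (hermite_coeff f \<alpha>) \<le>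
      C * sqrt (enn2real (K_int (tanh (2 * t)) f fhat)) * ((2 * real (\<alpha> $ j) + 1) powr (1 / 4) * exp (- (t * real (\<alpha> $ j))))" for C
  proof (intro exI[of _ C] conjI allI impI C)
    fix a t :: real and \<alpha> :: "nat ^ 'n"
    assume K: "K_int a f fhat < \<infinity>" and t: "t > 0" and a: "a = tanh (2 * t)"
    let ?B = "C * sqrt (enn2real (K_int a f fhat))"
    let ?u = "\<lambda>j. (2 * real (\<alpha> $ j) + 1) powr (1 / 4) * exp (- (t * real (\<alpha> $ j)))"
    have "norm (hermite_coeff f \<alpha>) \<le> ?B * (\<Prod>j\<in>UNIV. ?u j powr (1 / ?n))"
      using coord[OF t, of \<alpha>] K C unfolding a by (intro le_geometric_mean) auto
    also have "(\<Prod>j\<in>UNIV. ?u j powr (1 / ?n)) = (\<Prod>j\<in>UNIV. (2 * real (\<alpha> $ j) + 1) powr (1 / (4 * ?n))) * (\<Prod>j\<in>UNIV. exp (- (t * real (\<alpha> $ j) / ?n)))"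
      by (simp add: powr_mult powr_powr exp_powr_real prod.distrib)
    also have "(\<Prod>j\<in>UNIV. exp (- (t * real (\<alpha> $ j) / ?n))) = exp (- (t * real (\<Sum>j\<in>UNIV. \<alpha> $ j) / ?n))"
      by (simp add: exp_sum[symmetric] sum_negf sum_divide_distrib[symmetric] sum_distrib_left[symmetric])
    also have "- (t * real (\<Sum>j\<in>UNIV. \<alpha> $ j) / ?n) = t / 2 + - ((2 * real (\<Sum>j\<in>UNIV. \<alpha> $ j) + ?n) * t / (2 * ?n))"
      using n by (simp add: field_simps)
    finally show "norm (hermite_coeff f \<alpha>) \<le> C * exp (t / 2) * sqrt (enn2real (K_int a f fhat)) *
         (\<Prod>j\<in>UNIV. (2 * real (\<alpha> $ j) + 1) powr (1 / (4 * ?n))) *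
         exp (- ((2 * real (\<Sum>j\<in>UNIV. \<alpha> $ j) + ?n) * t / (2 * ?n)))"
      unfolding exp_add by (simp only: mult_ac)
  qed
  show ?thesis
  proof (cases "\<forall>z. bargmann_transform f z = 0")
    case True
    hence "hermite_coeff f \<alpha> = 0" for \<alpha>
      by (intro hermite_coeff_eq_0_if_bargmann_transform_eq_0 sq) auto
    thus ?thesis by (intro reduce[of 1]) auto
  next
    case nonzero: False
    have c0: "c \<noteq> 0"
    proof
      assume "c = 0"
      hence "bargmann_transform f z = 0" for z using eig[of "\<lambda>i. \<i> * z i"] by simp
      with nonzero show False by simp
    qed
    show ?thesis
    proof (cases "\<exists>t>0. K_int (tanh (2 * t)) f fhat < \<infinity>")
      case False
      thus ?thesis by (intro reduce[of 1]) auto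
    next
      case True
      \<comment> \<open>The number \<open>t0\<close> depends on \<open>f\<close> only, so constants that depend on it are admissible.\<close>
      then obtain t0 where t0: "t0 > 0" "K_int (tanh (2 * t0)) f fhat < \<infinity>" by blast
      define M where "M = 2 * sqrt (max (1 / norm c) (1 / norm c ^ 3)) * (10 / sqrt (1 - exp (- 4 * t0))) ^ (CARD('n) - 1)"
      have M: "M > 0" using c0 t0 by (auto simp: M_def less_max_iff_disj intro!: mult_pos_pos zero_less_power divide_pos_pos)
      define k where "k = (\<lambda>a. enn2real (K_int a f fhat))"
      have large: "norm (hermite_coeff f \<alpha>) \<le> M * sqrt (k (tanh (2 * t))) * ((2 * real (\<alpha> $ j) + 1) powr (1 / 4) * exp (- (t * real (\<alpha> $ j))))"
        if "t \<ge> t0" "K_int (tanh (2 * t)) f fhat < \<infinity>" for t \<alpha> j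
        using hermite_coeff_coordinate_bound[OF sq c0 hat eig t0(1) that(1) refl that(2), of \<alpha> j]
        by (simp add: M_def k_def mult.assoc)
      have fin0: "K_int 0 f fhat < \<infinity>"
        using K_int_mono[of 0 "tanh (2 * t0)" f fhat] t0 by (auto intro: le_less_trans)
      have "K_int 0 f fhat \<noteq> 0"
        using bargmann_transform_eq_0_if_K_int_0[OF sq] nonzero c0 hat by auto
      hence k0: "k 0 > 0" using fin0 by (simp add: k_def enn2real_positive_iff zero_less_iff_neq_zero)
      define C where "C = M * sqrt (max 1 (k (tanh (2 * t0)) / k 0))"
      have CM: "M \<le> C" using M by (simp add: C_def)
      show ?thesis
      proof (rule reduce[of C])
        show "C > 0" using CM M by linarith
        fix t :: real and \<alpha> :: "nat ^ 'n" and j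
        assume t: "t > 0" and K: "K_int (tanh (2 * t)) f fhat < \<infinity>"
        let ?p = "(2 * real (\<alpha> $ j) + 1) powr (1 / 4)"
        have "norm (hermite_coeff f \<alpha>) \<le> C * sqrt (k (tanh (2 * t))) * (?p * exp (- (t * real (\<alpha> $ j))))"
        proof (cases "t \<ge> t0")
          case True
          from large[OF this K, of \<alpha> j] show ?thesis
            by (rule order_trans) (intro mult_right_mono CM; simp add: k_def)
        next
          case False
          \<comment> \<open>For small \<open>t\<close> the bound at \<open>t0\<close> is even stronger, except that it contains \<open>K\<close> at \<open>t0\<close>;
              the lower bound \<open>k 0 > 0\<close> turns that into a constant times \<open>K\<close> at \<open>t\<close>.\<close>
          have "k 0 \<le> k (tanh (2 * t))"
            unfolding k_def using K t by (intro enn2real_mono K_int_mono) auto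
          hence "k (tanh (2 * t0)) * k 0 \<le> k (tanh (2 * t0)) * k (tanh (2 * t))"
            by (intro mult_left_mono) (auto simp: k_def)
          hence "k (tanh (2 * t0)) \<le> k (tanh (2 * t0)) / k 0 * k (tanh (2 * t))"
            using k0 by (simp add: pos_le_divide_eq)
          also have "\<dots> \<le> max 1 (k (tanh (2 * t0)) / k 0) * k (tanh (2 * t))"
            by (intro mult_right_mono) (auto simp: k_def)
          finally have "sqrt (k (tanh (2 * t0))) \<le> sqrt (max 1 (k (tanh (2 * t0)) / k 0)) * sqrt (k (tanh (2 * t)))"
            by (simp flip: real_sqrt_mult)
          hence "M * sqrt (k (tanh (2 * t0))) \<le> C * sqrt (k (tanh (2 * t)))"
            unfolding C_def mult.assoc using M by (intro mult_left_mono) auto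
          moreover have "exp (- (t0 * real (\<alpha> $ j))) \<le> exp (- (t * real (\<alpha> $ j)))"
            using False by (simp add: mult_right_mono)
          ultimately have "M * sqrt (k (tanh (2 * t0))) * (?p * exp (- (t0 * real (\<alpha> $ j)))) \<le> C * sqrt (k (tanh (2 * t))) * (?p * exp (- (t * real (\<alpha> $ j))))"
            using CM M by (intro mult_mono[OF _ mult_left_mono]) (auto simp del: exp_le_cancel_iff simp: k_def)
          with large[OF order_refl t0(2), of \<alpha> j] show ?thesis by linarith
        qed
        thus "norm (hermite_coeff f \<alpha>) \<le> C * sqrt (enn2real (K_int (tanh (2 * t)) f fhat)) * (?p * exp (- (t * real (\<alpha> $ j))))"
          by (simp add: k_def)
      qed
    qed
  qed
qed

end
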